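(* Let $\mathbb{K}$ be a semiring and $A$ a finite alphabet. If $\mathcal{A}$ is a $\mathbb{K}$-automaton with $n$ states and $m$ transitions with simplifiable signatures, the Fast Predecessor Class Split Algorithm computes the minimal quotient of $\mathcal{A}$ in time $O((m+n)\log n)$ (under the assumption that each semiring operation on weights and the computation of a hash of a weight take constant time).
   Context: A $\mathbb{K}$-automaton $\langle I,E,T\rangle$ of dimension $Q$ over $A^*$ has initial row vector $I$, final column vector $T$, transition weights $E\colon Q\times A\times Q\to\mathbb{K}$ (a transition is a triple with nonzero weight). A surjective $\varphi\colon Q\to R$ is a morphism onto $\langle J,F,U\rangle$ if, with $M_\varphi$ the $Q\times R$ 0/1 amalgamation matrix of $\varphi$ and $E_a=(E(p,a,q))_{p,q}$, $IM_\varphi=J$, $E_aM_\varphi=M_\varphi F_a$ ($a\in A$), $T=M_\varphi U$; the minimal quotient is the quotient by the coarsest congruence (kernel of a morphism coarser than all such kernels). The algorithm works on the augmented automaton: new letter $\$$, $A_\$=A\cup\{\$\}$, new states $i,t$, extra transitions $E(i,\$,p)=I_p$, $E(q,\$,t)=T_q$. Signature of $p$ w.r.t. a set $D$: $\sigma_{p,D}\colon A_\$\to\mathbb{K}$, $\sigma_{p,D}(a)=\sum_{q\in D}E(p,a,q)$. The automaton has simplifiable signatures if for all sets $C\subseteq D$ of states and states $p,q$, $\sigma_{p,D}=\sigma_{q,D}$ and $\sigma_{p,C}=\sigma_{q,C}$ imply $\sigma_{p,D\setminus C}=\sigma_{q,D\setminus C}$. Fast Predecessor Class Split Algorithm: start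 with partition $\{\{i\},Q,\{t\}\}$ and a queue containing $Q$ and $\{t\}$; while the queue is nonempty, extract a class $D$; for every class $C$ containing a state with a transition into $D$, split $C$ into maximal sets of states having equal signature w.r.t. $D$; if $C$ is split and was in the queue it is replaced in the queue by all its subclasses, and if $C$ was not in the queue all subclasses except one of largest size are inserted into the queue. Signatures are grouped by a weak sort (bucket sort with linked hash maps, amortised constant-time access) and classes are doubly linked lists with constant-time deletion. The output partition defines the minimal quotient. *)

theory Defs
  imports Complex_Main "HOL-Library.Monad_Syntax"
begin

section \<open>Automata, morphisms, minimal quotient\<close>

text \<open>
  The values of the three weight functions outside \<open>states\<close> are irrelevant: everything
  below is relativised to \<open>states\<close>.  The alphabet is the letter type itself, assumed
  to be of class \<open>finite\<close>.  The sort of semirings with unit is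
  \<open>{semiring_0, monoid_mult}\<close> (unlike \<open>semiring_1\<close>, it does not demand that 0 and 1 differ).
\<close>

record ('q, 'a, 'k) automaton =
  states :: "'q set"
  initial_weight :: "'q \<Rightarrow> 'k"
  weight :: "'q \<Rightarrow> 'a \<Rightarrow> 'q \<Rightarrow> 'k"
  final_weight :: "'q \<Rightarrow> 'k"

definition transitions :: "('q, 'a, 'k::zero) automaton \<Rightarrow> ('q \<times> 'a \<times> 'q) set" where
  "transitions A = {(p, a, q). p \<in> states A \<and> q \<in> states A \<and> weight A p a q \<noteq> 0}"

definition amalgamation :: "('q \<Rightarrow> 'r) \<Rightarrow> 'q \<Rightarrow> 'r \<Rightarrow> 'k::{semiring_0, monoid_mult}" where
  "amalgamation \<phi> p r = (if \<phi> p = r then 1 else 0)"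

definition is_morphism ::
  "('q \<Rightarrow> 'r) \<Rightarrow> ('q, 'a, 'k::{semiring_0, monoid_mult}) automaton \<Rightarrow> ('r, 'a, 'k) automaton \<Rightarrow> bool" where
  "is_morphism \<phi> A B \<longleftrightarrow>
     \<phi> ` states A = states B \<and>
     (\<forall>r\<in>states B. (\<Sum>p\<in>states A. initial_weight A p * amalgamation \<phi> p r) = initial_weight B r) \<and>
     (\<forall>a. \<forall>p\<in>states A. \<forall>r\<in>states B.
        (\<Sum>q\<in>states A. weight A p a q * amalgamation \<phi> q r)
          = (\<Sum>s\<in>states B. amalgamation \<phi> p s * weight B s a r)) \<and>
     (\<forall>p\<in>states A. final_weight A p = (\<Sum>r\<in>states B. amalgamation \<phi> p r * final_weight B r))"

definition kernel_on :: "'q set \<Rightarrow> ('q \<Rightarrow> 'r) \<Rightarrow> ('q \<times> 'q) set" where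
  "kernel_on Q \<phi> = {(p, q). p \<in> Q \<and> q \<in> Q \<and> \<phi> p = \<phi> q}"

text \<open>
  HOL cannot quantify over the type of the states of the target; subsets of the states of the
  source suffice, because every morphism factors through a renaming of the states of its image
  by the corresponding kernel classes.
\<close>

definition congruence :: "('q, 'a, 'k::{semiring_0, monoid_mult}) automaton \<Rightarrow> ('q \<times> 'q) set \<Rightarrow> bool" where
  "congruence A r \<longleftrightarrow>
     (\<exists>(\<phi> :: 'q \<Rightarrow> 'q set) (B :: ('q set, 'a, 'k) automaton).
        is_morphism \<phi> A B \<and> r = kernel_on (states A) \<phi>)"

definition coarsest_congruence ::
  "('q, 'a, 'k::{semiring_0, monoid_mult}) automaton \<Rightarrow> ('q \<times> 'q) set \<Rightarrow> bool" where
  "coarsest_congruence A r \<longleftrightarrow> congruence A r \<and> (\<forall>s. congruence A s \<longrightarrow> s \<subseteq> r)"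

definition is_minimal_quotient ::
  "('q, 'a, 'k::{semiring_0, monoid_mult}) automaton \<Rightarrow> ('q set, 'a, 'k) automaton \<Rightarrow> bool" where
  "is_minimal_quotient A B \<longleftrightarrow>
     (\<exists>r. coarsest_congruence A r \<and> states B = states A // r \<and> is_morphism (\<lambda>p. r `` {p}) A B)"

text \<open>
  The automaton defined by a partition \<open>P\<close> of the states.  It is only meaningful when the
  chosen representatives do not matter, which \<open>is_minimal_quotient A (quotient_by A P)\<close> entails.
\<close>

definition quotient_by ::
  "('q, 'a, 'k::{semiring_0, monoid_mult}) automaton \<Rightarrow> 'q set set \<Rightarrow> ('q set, 'a, 'k) automaton" where
  "quotient_by A P =
     \<lparr> states = P,
       initial_weight = (\<lambda>C. \<Sum>p\<in>C. initial_weight A p),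
       weight = (\<lambda>C a D. \<Sum>q\<in>D. weight A (SOME p. p \<in> C) a q),
       final_weight = (\<lambda>C. final_weight A (SOME p. p \<in> C)) \<rparr>"


section \<open>Augmented automaton and signatures\<close>

datatype 'q astate = Ini | St 'q | Fin

text \<open>The augmented alphabet is \<open>'a option\<close>; the additional letter is \<open>None\<close>.\<close>

fun aug_weight ::
  "('q, 'a, 'k::zero) automaton \<Rightarrow> 'q astate \<Rightarrow> 'a option \<Rightarrow> 'q astate \<Rightarrow> 'k" where
  "aug_weight A Ini None (St p) = initial_weight A p"
| "aug_weight A (St p) (Some a) (St q) = weight A p a q"
| "aug_weight A (St q) None Fin = final_weight A q"
| "aug_weight A _ _ _ = 0"

definition signature ::
  "('q, 'a, 'k::semiring_0) automaton \<Rightarrow> 'q astate \<Rightarrow> 'q astate set \<Rightarrow> 'a option \<Rightarrow> 'k" where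
  "signature A p D = (\<lambda>a. \<Sum>q\<in>D. aug_weight A p a q)"

text \<open>
  The states are those of the given automaton.  For \<open>p\<close> and \<open>q\<close> among these, letting \<open>D\<close> range
  over all sets of augmented states would give an equivalent condition: no transition enters
  \<open>Ini\<close>, and \<open>Fin\<close> is the only state that contributes to the additional letter.
\<close>

definition simplifiable_signatures :: "('q, 'a, 'k::semiring_0) automaton \<Rightarrow> bool" where
  "simplifiable_signatures A \<longleftrightarrow>
     (\<forall>C D p q. C \<subseteq> D \<and> D \<subseteq> St ` states A \<and> p \<in> St ` states A \<and> q \<in> St ` states A \<and>
        signature A p D = signature A q D \<and> signature A p C = signature A q C
        \<longrightarrow> signature A p (D - C) = signature A q (D - C))"


section \<open>Nondeterministic programs with running time\<close>

text \<open>
  A program is the set of its possible outcomes, each with the number of elementary operations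
  that were executed.  The nondeterminism covers what the algorithm leaves open: the order in
  which a set is traversed, which class is extracted from the queue, and which of the largest
  subclasses is left out.
\<close>

datatype 'x prog = Prog (outcomes: "('x \<times> nat) set")

definition ret :: "'x \<Rightarrow> 'x prog" where
  "ret x = Prog {(x, 0)}"

definition bind_prog :: "'x prog \<Rightarrow> ('x \<Rightarrow> 'y prog) \<Rightarrow> 'y prog" where
  "bind_prog m f = Prog {(y, t + u) | x t y u. (x, t) \<in> outcomes m \<and> (y, u) \<in> outcomes (f x)}"

adhoc_overloading
  Monad_Syntax.bind \<rightleftharpoons> bind_prog

text \<open>
  One elementary operation: a semiring addition or a comparison of weights, one access to an
  array or to a hash map (with key built from a weight, a letter and class numbers), insertion
  into or deletion from a linked list, or an operation on counters or flags.
\<close>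

definition op1 :: "'x \<Rightarrow> 'x prog" where
  "op1 x = Prog {(x, 1)}"

text \<open>Only applied to nonempty sets: \<open>pick {}\<close> would have no outcome.\<close>

definition pick :: "'x set \<Rightarrow> 'x prog" where
  "pick S = Prog {(x, 1) | x. x \<in> S}"

primrec for_list :: "('x \<Rightarrow> 's \<Rightarrow> 's prog) \<Rightarrow> 'x list \<Rightarrow> 's \<Rightarrow> 's prog" where
  "for_list f [] s = op1 s"
| "for_list f (x # xs) s = do { s' \<leftarrow> op1 s; s'' \<leftarrow> f x s'; for_list f xs s'' }"

text \<open>
  Traversal of a (finite) linked list or of the keys of a linked hash map, in an arbitrary order.
\<close>

definition foreach :: "'x set \<Rightarrow> ('x \<Rightarrow> 's \<Rightarrow> 's prog) \<Rightarrow> 's \<Rightarrow> 's prog" where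
  "foreach S f s = Prog (\<Union>xs\<in>{xs. distinct xs \<and> set xs = S}. outcomes (for_list f xs s))"

inductive loop :: "('s \<Rightarrow> bool) \<Rightarrow> ('s \<Rightarrow> 's prog) \<Rightarrow> 's \<Rightarrow> 's \<Rightarrow> nat \<Rightarrow> bool" for b body where
  loop_exit: "\<not> b s \<Longrightarrow> loop b body s s 1"
| loop_step: "b s \<Longrightarrow> (s', t) \<in> outcomes (body s) \<Longrightarrow> loop b body s' s'' u
    \<Longrightarrow> loop b body s s'' (1 + t + u)"

definition while_prog :: "('s \<Rightarrow> bool) \<Rightarrow> ('s \<Rightarrow> 's prog) \<Rightarrow> 's \<Rightarrow> 's prog" where
  "while_prog b body s = Prog {(s', t). loop b body s s' t}"

text \<open>
  The outcomes of \<open>while_prog\<close> only record terminating executions.  The following predicate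
  states that every execution terminates and that none gets stuck.
\<close>

inductive loop_halts :: "('s \<Rightarrow> bool) \<Rightarrow> ('s \<Rightarrow> 's prog) \<Rightarrow> 's \<Rightarrow> bool" for b body where
  halts_exit: "\<not> b s \<Longrightarrow> loop_halts b body s"
| halts_step: "b s \<Longrightarrow> outcomes (body s) \<noteq> {}
    \<Longrightarrow> (\<And>s' t. (s', t) \<in> outcomes (body s) \<Longrightarrow> loop_halts b body s')
    \<Longrightarrow> loop_halts b body s"


section \<open>Fast Predecessor Class Split Algorithm\<close>

text \<open>
  Classes carry numbers; \<open>members\<close> gives the linked list of each class (with its length), and a
  number whose list is empty stands for no class.  \<open>preds\<close> gives the incoming transitions of a
  state of the augmented automaton, as triples of source, letter and weight.
\<close>

record ('q, 'a, 'k) store =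
  preds :: "'q astate \<Rightarrow> ('q astate \<times> 'a option \<times> 'k) set"
  class_of :: "'q astate \<Rightarrow> nat"
  members :: "nat \<Rightarrow> 'q astate set"
  next_class :: nat
  queue :: "nat set"

definition add_pred ::
  "'q astate \<Rightarrow> 'a option \<Rightarrow> 'k \<Rightarrow> 'q astate \<Rightarrow> ('q, 'a, 'k) store \<Rightarrow> ('q, 'a, 'k) store prog" where
  "add_pred p a k q s = op1 (s\<lparr> preds := (preds s)(q := insert (p, a, k) (preds s q)) \<rparr>)"

text \<open>
  Reads the automaton, builds the augmented automaton, and sets up the initial partition
  with classes 0 (the state \<open>Ini\<close>), 1 (the states of the given automaton) and 2 (the state \<open>Fin\<close>).
\<close>

definition init_store :: "('q, 'a, 'k::semiring_0) automaton \<Rightarrow> ('q, 'a, 'k) store prog" where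
  "init_store A = do {
     s \<leftarrow> op1 \<lparr> preds = (\<lambda>_. {}),
                class_of = (\<lambda>_. 0)(Ini := 0, Fin := 2),
                members = (\<lambda>_. {})(0 := {Ini}, 2 := {Fin}),
                next_class = 3,
                queue = {1, 2} \<rparr>;
     s \<leftarrow> foreach (transitions A)
            (\<lambda>(p, a, q) s. add_pred (St p) (Some a) (weight A p a q) (St q) s) s;
     foreach (states A)
       (\<lambda>q s. do {
          s \<leftarrow> op1 (s\<lparr> class_of := (class_of s)(St q := 1) \<rparr>);
          s \<leftarrow> op1 (s\<lparr> members := (members s)(1 := insert (St q) (members s 1)) \<rparr>);
          z \<leftarrow> op1 (initial_weight A q = 0);
          s \<leftarrow> (if z then ret s else add_pred Ini None (initial_weight A q) (St q) s);
          z \<leftarrow> op1 (final_weight A q = 0);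
          (if z then ret s else add_pred (St q) None (final_weight A q) Fin s) }) s }"

text \<open>
  The signatures with respect to a class, as a hash map from letters to hash maps from states to
  weights: only states with a transition into the class occur.
\<close>

type_synonym ('q, 'a, 'k) sigtab = "'a option \<rightharpoonup> ('q astate \<rightharpoonup> 'k)"

definition add_weight ::
  "'q astate \<Rightarrow> 'a option \<Rightarrow> 'k::semiring_0 \<Rightarrow> ('q, 'a, 'k) sigtab \<Rightarrow> ('q, 'a, 'k) sigtab prog" where
  "add_weight p a k tab = do {
     row \<leftarrow> op1 (case tab a of None \<Rightarrow> Map.empty | Some row \<Rightarrow> row);
     old \<leftarrow> op1 (case row p of None \<Rightarrow> 0 | Some l \<Rightarrow> l);
     new \<leftarrow> op1 (old + k);
     row \<leftarrow> op1 (row(p \<mapsto> new));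
     op1 (tab(a \<mapsto> row)) }"

definition compute_signatures ::
  "nat \<Rightarrow> ('q, 'a, 'k::semiring_0) store \<Rightarrow> ('q, 'a, 'k) sigtab prog" where
  "compute_signatures D s =
     foreach (members s D)
       (\<lambda>q tab. foreach (preds s q) (\<lambda>(p, a, k) tab. add_weight p a k tab) tab)
       Map.empty"

text \<open>
  Bucket sort of the signatures, one letter after the other, in the same order of letters for all
  states.  A state moves from its bucket \<open>g\<close> to the bucket with key \<open>(g, a, k)\<close> when its signature
  has the nonzero value \<open>k\<close> at the letter \<open>a\<close>.  Everybody starts in bucket 0, so eventually bucket 0
  contains the states with zero signature, with or without transitions into the class; these
  states have no entry in \<open>bucket_of\<close>.
\<close>

record ('q, 'a, 'k) buckets =
  bucket_of :: "'q astate \<rightharpoonup> nat"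
  bucket_key :: "nat \<times> 'a option \<times> 'k \<rightharpoonup> nat"
  next_bucket :: nat

definition place ::
  "'a option \<Rightarrow> ('q astate \<rightharpoonup> 'k::semiring_0) \<Rightarrow> 'q astate \<Rightarrow> ('q, 'a, 'k) buckets
     \<Rightarrow> ('q, 'a, 'k) buckets prog" where
  "place a row p bs = do {
     k \<leftarrow> op1 (the (row p));
     z \<leftarrow> op1 (k = 0);
     if z then ret bs
     else do {
       g \<leftarrow> op1 (case bucket_of bs p of None \<Rightarrow> 0 | Some g \<Rightarrow> g);
       h \<leftarrow> op1 (bucket_key bs (g, a, k));
       case h of
         Some g' \<Rightarrow> op1 (bs\<lparr> bucket_of := (bucket_of bs)(p \<mapsto> g') \<rparr>)
       | None \<Rightarrow> do {
           g' \<leftarrow> op1 (next_bucket bs);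
           bs \<leftarrow> op1 (bs\<lparr> next_bucket := g' + 1 \<rparr>);
           bs \<leftarrow> op1 (bs\<lparr> bucket_key := (bucket_key bs)((g, a, k) \<mapsto> g') \<rparr>);
           op1 (bs\<lparr> bucket_of := (bucket_of bs)(p \<mapsto> g') \<rparr>) } } }"

definition weak_sort :: "('q, 'a, 'k::semiring_0) sigtab \<Rightarrow> ('q astate \<rightharpoonup> nat) prog" where
  "weak_sort tab = do {
     bs \<leftarrow> op1 \<lparr> bucket_of = Map.empty, bucket_key = Map.empty, next_bucket = 1 \<rparr>;
     bs \<leftarrow> foreach (dom tab)
             (\<lambda>a bs. do {
                row \<leftarrow> op1 (the (tab a));
                foreach (dom row) (place a row) bs }) bs;
     ret (bucket_of bs) }"

text \<open>
  Splitting of the classes.  The states with nonzero signature leave their class \<open>C\<close> and form one new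
  class for each bucket; the states with zero signature, if any, keep the number \<open>C\<close>.
  \<open>part_at\<close> is indexed by class and bucket, and \<open>parts\<close> collects the new classes of a class.
\<close>

record ('q, 'a, 'k) split_state =
  st :: "('q, 'a, 'k) store"
  part_at :: "nat \<times> nat \<rightharpoonup> nat"
  parts :: "nat \<rightharpoonup> nat set"

definition find_subclass ::
  "nat \<Rightarrow> nat \<Rightarrow> ('q, 'a, 'k) split_state \<Rightarrow> (nat \<times> ('q, 'a, 'k) split_state) prog" where
  "find_subclass C g w = do {
     e \<leftarrow> op1 (part_at w (C, g));
     case e of
       Some N \<Rightarrow> ret (N, w)
     | None \<Rightarrow> do {
         N \<leftarrow> op1 (next_class (st w));
         w \<leftarrow> op1 (w\<lparr> st := (st w)\<lparr> next_class := N + 1 \<rparr> \<rparr>);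
         w \<leftarrow> op1 (w\<lparr> part_at := (part_at w)((C, g) \<mapsto> N) \<rparr>);
         old \<leftarrow> op1 (case parts w C of None \<Rightarrow> {} | Some Ns \<Rightarrow> Ns);
         w \<leftarrow> op1 (w\<lparr> parts := (parts w)(C \<mapsto> insert N old) \<rparr>);
         ret (N, w) } }"

definition move_state ::
  "('q astate \<rightharpoonup> nat) \<Rightarrow> 'q astate \<Rightarrow> ('q, 'a, 'k) split_state \<Rightarrow> ('q, 'a, 'k) split_state prog" where
  "move_state grp p w = do {
     g \<leftarrow> op1 (the (grp p));
     C \<leftarrow> op1 (class_of (st w) p);
     (N, w) \<leftarrow> find_subclass C g w;
     s \<leftarrow> op1 (st w);
     s \<leftarrow> op1 (s\<lparr> members := (members s)(C := members s C - {p}) \<rparr>);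
     s \<leftarrow> op1 (s\<lparr> members := (members s)(N := insert p (members s N)) \<rparr>);
     s \<leftarrow> op1 (s\<lparr> class_of := (class_of s)(p := N) \<rparr>);
     op1 (w\<lparr> st := s \<rparr>) }"

definition split_classes ::
  "('q astate \<rightharpoonup> nat) \<Rightarrow> ('q, 'a, 'k) store \<Rightarrow> ('q, 'a, 'k) split_state prog" where
  "split_classes grp s = do {
     w \<leftarrow> op1 \<lparr> st = s, part_at = Map.empty, parts = Map.empty \<rparr>;
     foreach (dom grp) (move_state grp) w }"

text \<open>
  One of the classes in \<open>Ns\<close> of largest size; the scan inspects each stored length once.
\<close>

definition pick_largest :: "nat set \<Rightarrow> ('q, 'a, 'k) store \<Rightarrow> nat prog" where
  "pick_largest Ns s = do {
     _ \<leftarrow> foreach Ns (\<lambda>N _. op1 ()) ();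
     pick {L \<in> Ns. \<forall>N\<in>Ns. card (members s N) \<le> card (members s L)} }"

definition enqueue_all :: "nat set \<Rightarrow> ('q, 'a, 'k) store \<Rightarrow> ('q, 'a, 'k) store prog" where
  "enqueue_all Ns s = foreach Ns (\<lambda>N s. op1 (s\<lparr> queue := insert N (queue s) \<rparr>)) s"

definition requeue ::
  "(nat \<rightharpoonup> nat set) \<Rightarrow> nat \<Rightarrow> ('q, 'a, 'k) store \<Rightarrow> ('q, 'a, 'k) store prog" where
  "requeue prts C s = do {
     Ns \<leftarrow> op1 (the (prts C));
     none_left \<leftarrow> op1 (members s C = {});
     subs \<leftarrow> op1 (if none_left then Ns else insert C Ns);
     queued \<leftarrow> op1 (C \<in> queue s);
     if queued then do {
       s \<leftarrow> op1 (s\<lparr> queue := queue s - {C} \<rparr>);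
       enqueue_all subs s }
     else do {
       L \<leftarrow> pick_largest subs s;
       rest \<leftarrow> op1 (subs - {L});
       enqueue_all rest s } }"

definition split_round :: "('q, 'a, 'k::semiring_0) store \<Rightarrow> ('q, 'a, 'k) store prog" where
  "split_round s = do {
     D \<leftarrow> pick (queue s);
     s \<leftarrow> op1 (s\<lparr> queue := queue s - {D} \<rparr>);
     tab \<leftarrow> compute_signatures D s;
     grp \<leftarrow> weak_sort tab;
     w \<leftarrow> split_classes grp s;
     foreach (dom (parts w)) (requeue (parts w)) (st w) }"

definition output_partition :: "('q, 'a, 'k) store \<Rightarrow> 'q set set" where
  "output_partition s = (\<lambda>C. {q. St q \<in> members s C}) ` {..<next_class s} - {{}}"

definition fpcs :: "('q, 'a, 'k::semiring_0) automaton \<Rightarrow> 'q set set prog" where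
  "fpcs A = do {
     s \<leftarrow> init_store A;
     s \<leftarrow> while_prog (\<lambda>s. queue s \<noteq> {}) split_round s;
     ret (output_partition s) }"

definition fpcs_halts :: "('q, 'a, 'k::semiring_0) automaton \<Rightarrow> bool" where
  "fpcs_halts A \<longleftrightarrow>
     outcomes (init_store A) \<noteq> {} \<and>
     (\<forall>(s, t) \<in> outcomes (init_store A). loop_halts (\<lambda>s. queue s \<noteq> {}) split_round s)"

end

theory Submission
  imports Defs "HOL-Library.Discrete_Functions"
begin

text \<open>
  Correctness follows Hopcroft's argument.  The partition is always coarser than every congruence, and
  every class \<open>C\<close> outside the queue is contained in a stable union of \<open>C\<close> and classes of the queue.
  Extracting one of the latter makes it stable as well, so with simplifiable signatures it can be
  subtracted from the union; once the queue is empty, every class is stable.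

  For the running time, a round costs at most a constant for every state of the extracted class and
  every transition into it.  A class outside the queue enters it only by a split that at least halves
  the size, so every state is extracted \<open>O(log n)\<close> times.
\<close>

section \<open>Weakest preconditions\<close>

text \<open>Both arguments see a round only through the relation \<open>split_by\<close>, which
  holds for every order of traversal and every choice among the largest subclasses. Establishing it
  has one delicate point: a round visits only states with a transition into the extracted class, yet
  visited states whose weights sum to zero must stay together with the unvisited ones. Therefore
  zero signatures share bucket 0 and keep the old class number, and only states with nonzero
  signature move.

  The stable union around \<open>C\<close> is left existential: which queued classes complete
  \<open>C\<close> depends on the history of the splits, whereas the existence of some such family
  survives a round.

  The scale of the potential: with \<open>W\<close> the number of states of the extracted class plus
  the number of transitions into it, a round costs at most \<open>8 + 49 * W\<close>, the loop test
  adds 1, and \<open>9 + 49 * W\<close> is at most 58 times any amount that is at least both 1 and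
  \<open>W\<close>.\<close>

definition wp :: "'x prog \<Rightarrow> ('x \<Rightarrow> nat \<Rightarrow> bool) \<Rightarrow> bool" where
  "wp m Q \<longleftrightarrow> outcomes m \<noteq> {} \<and> (\<forall>(x, t)\<in>outcomes m. Q x t)"

lemma wp_mono: "wp m P \<Longrightarrow> (\<And>x t. P x t \<Longrightarrow> Q x t) \<Longrightarrow> wp m Q"
  unfolding wp_def by blast

lemma wpD: "wp m Q \<Longrightarrow> (x, t) \<in> outcomes m \<Longrightarrow> Q x t"
  unfolding wp_def by blast

lemma wp_ret [simp]: "wp (ret x) Q \<longleftrightarrow> Q x 0"
  by (simp add: wp_def ret_def)

lemma wp_op1 [simp]: "wp (op1 x) Q \<longleftrightarrow> Q x 1"
  by (simp add: wp_def op1_def)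

lemma wp_pick [simp]: "wp (pick S) Q \<longleftrightarrow> S \<noteq> {} \<and> (\<forall>x\<in>S. Q x 1)"
  by (auto simp: wp_def pick_def)

lemma outcomes_bind:
  "outcomes (bind_prog m f) = (\<Union>(x, t)\<in>outcomes m. (\<lambda>(y, u). (y, t + u)) ` outcomes (f x))"
  by (fastforce simp: bind_prog_def)

text \<open>The converse fails: if some \<open>f x\<close> has no outcome, the result
  \<open>x\<close> silently disappears from the composition, while the premise demands that no
  branch is stuck.\<close>

lemma wp_bind: "wp m (\<lambda>x t. wp (f x) (\<lambda>y u. Q y (t + u))) \<Longrightarrow> wp (bind_prog m f) Q"
  by (fastforce simp: wp_def outcomes_bind)

lemma wp_bind_op1 [simp]: "wp (bind_prog (op1 x) f) Q \<longleftrightarrow> wp (f x) (\<lambda>y u. Q y (Suc u))"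
  by (auto simp: wp_def outcomes_bind op1_def)

lemma wp_bind_ret [simp]: "wp (bind_prog (ret x) f) Q \<longleftrightarrow> wp (f x) Q"
  by (auto simp: wp_def outcomes_bind ret_def)

text \<open>The invariant is indexed by the set of treated elements instead of a prefix, so it
  cannot depend on the order of the list. Each element is charged one operation of the traversal on
  top of \<open>c x\<close>; the remaining 1 is the detection of the end.\<close>

lemma wp_for_list:
  assumes step: "\<And>R x s. R \<subseteq> S \<Longrightarrow> x \<in> S \<Longrightarrow> x \<notin> R \<Longrightarrow> I R s \<Longrightarrow>
      wp (f x s) (\<lambda>s' u. I (insert x R) s' \<and> u \<le> c x)"
  shows "distinct xs \<Longrightarrow> R \<union> set xs \<subseteq> S \<Longrightarrow> R \<inter> set xs = {} \<Longrightarrow> I R s \<Longrightarrow>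
    wp (for_list f xs s) (\<lambda>s' t. I (R \<union> set xs) s' \<and> t \<le> 1 + (\<Sum>x\<in>set xs. 1 + c x))"
proof (induction xs arbitrary: R s)
  case Nil
  then show ?case by simp
next
  case (Cons x xs)
  have "wp (f x s) (\<lambda>s' u. I (insert x R) s' \<and> u \<le> c x)"
    using Cons.prems by (intro step) auto
  then show ?case
  proof (simp, intro wp_bind, elim wp_mono)
    fix s' u
    assume *: "I (insert x R) s' \<and> u \<le> c x"
    have "wp (for_list f xs s') (\<lambda>s'' t. I (insert x R \<union> set xs) s'' \<and> t \<le> 1 + (\<Sum>x\<in>set xs. 1 + c x))"
      using Cons.prems * by (intro Cons.IH) auto
    then show "wp (for_list f xs s')
        (\<lambda>y ua. I (insert x (R \<union> set xs)) y \<and> u + ua \<le> (\<Sum>x\<in>insert x (set xs). Suc (c x)))"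
      using Cons.prems * by (elim wp_mono) auto
  qed
qed

text \<open>Finiteness supplies an enumeration; without one the traversal would have no outcome at
  all.\<close>

lemma wp_foreach:
  assumes "finite S" and "I {} s"
    and "\<And>R x s. R \<subseteq> S \<Longrightarrow> x \<in> S \<Longrightarrow> x \<notin> R \<Longrightarrow> I R s \<Longrightarrow>
      wp (f x s) (\<lambda>s' u. I (insert x R) s' \<and> u \<le> c x)"
    and "\<And>s' t. I S s' \<Longrightarrow> t \<le> 1 + (\<Sum>x\<in>S. 1 + c x) \<Longrightarrow> Q s' t"
  shows "wp (foreach S f s) Q"
proof -
  have ex: "\<exists>xs. distinct xs \<and> set xs = S"
    using finite_distinct_list[OF assms(1)] by blast
  have "wp (for_list f xs s) Q" if "distinct xs" "set xs = S" for xs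
    using wp_for_list[of S I f c xs "{}" s] assms that by (force elim!: wp_mono)
  then show ?thesis
    using ex unfolding wp_def foreach_def by fastforce
qed

section \<open>Loops: termination and amortised cost\<close>

lemma loop_halts_measure:
  assumes "\<And>s. I s \<Longrightarrow> b s \<Longrightarrow> wp (body s) (\<lambda>s' t. I s' \<and> \<Phi> s' < (\<Phi> s :: nat))"
  shows "I s \<Longrightarrow> loop_halts b body s"
proof (induction "\<Phi> s" arbitrary: s rule: less_induct)
  case less
  show ?case
  proof (cases "b s")
    case True
    show ?thesis
      by (rule halts_step) (use True assms[OF less.prems True] less.hyps in \<open>auto simp: wp_def\<close>)
  qed (rule halts_exit)
qed

text \<open>The 1 in the premise pays for the successful loop test before the round, the 1 in the
  conclusion for the final, failing test.\<close>

lemma loop_amortised: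
  assumes "loop b body s s' t" and "I s"
    and "\<And>s. I s \<Longrightarrow> b s \<Longrightarrow> wp (body s) (\<lambda>s' t. I s' \<and> 1 + t + \<Phi> s' \<le> (\<Phi> s :: nat))"
  shows "I s' \<and> \<not> b s' \<and> t + \<Phi> s' \<le> 1 + \<Phi> s"
  using assms(1,2)
proof (induction rule: loop.induct)
  case (loop_step s s' t s'' u)
  then show ?case
    using wpD[OF assms(3)[OF loop_step.prems loop_step.hyps(1)] loop_step.hyps(2)] by auto
qed simp

section \<open>Signatures with respect to a class\<close>

definition aug_states :: "('q, 'a, 'k) automaton \<Rightarrow> 'q astate set" where
  "aug_states A = insert Ini (insert Fin (St ` states A))"

lemma finite_aug_states [simp]: "finite (aug_states A) \<longleftrightarrow> finite (states A)"
  by (auto simp: aug_states_def finite_image_iff inj_on_def)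

definition entry :: "('q, 'a, 'k::zero) sigtab \<Rightarrow> 'a option \<Rightarrow> 'q astate \<Rightarrow> 'k" where
  "entry tab a p = (case tab a of None \<Rightarrow> 0 | Some row \<Rightarrow> (case row p of None \<Rightarrow> 0 | Some k \<Rightarrow> k))"

text \<open>Entries whose accumulated weight is zero count as well: the cost of sorting depends on
  the cells present in the table, not on their values.\<close>

definition keys :: "('q, 'a, 'k) sigtab \<Rightarrow> ('a option \<times> 'q astate) set" where
  "keys tab = {(a, p). \<exists>row. tab a = Some row \<and> p \<in> dom row}"

definition key_of :: "'q astate \<times> 'a option \<times> 'k \<Rightarrow> 'a option \<times> 'q astate" where
  "key_of = (\<lambda>(p, a, k). (a, p))"

text \<open>The condition on \<open>dom tab\<close> excludes empty rows, so that later the number of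
  rows is bounded by the number of entries.\<close>

lemma wp_add_weight:
  fixes tab :: "('q, 'a, 'k::semiring_0) sigtab"
  assumes "dom tab = fst ` keys tab"
  shows "wp (add_weight p a k tab) (\<lambda>tab' t. t = 5 \<and>
     entry tab' = (\<lambda>b q. entry tab b q + (if q = p \<and> b = a then k else 0)) \<and>
     keys tab' = insert (a, p) (keys tab) \<and> dom tab' = fst ` keys tab')"
proof -
  have *: "keys (tab(a \<mapsto> row(p \<mapsto> l))) = insert (a, p) (keys tab)"
    if "row = (case tab a of None \<Rightarrow> Map.empty | Some row \<Rightarrow> row)" for row l
    using that by (auto simp: keys_def split: if_splits option.splits)
  have "dom (tab(a \<mapsto> row)) = insert a (fst ` keys tab)" for row
    using assms by simp
  with * show ?thesis
    by (auto simp: add_weight_def entry_def fun_eq_iff simp del: dom_fun_upd split: option.splits)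
qed

lemma wp_add_weights:
  fixes tab :: "('q, 'a, 'k::semiring_0) sigtab"
  assumes "finite T" and "dom tab = fst ` keys tab"
  shows "wp (foreach T (\<lambda>(p, a, k) tab. add_weight p a k tab) tab) (\<lambda>tab' t. t \<le> 1 + 6 * card T \<and>
     entry tab' = (\<lambda>b q. entry tab b q + (\<Sum>(p, a, k)\<in>T. if q = p \<and> b = a then k else 0)) \<and>
     keys tab' = key_of ` T \<union> keys tab \<and> dom tab' = fst ` keys tab')"
proof (rule wp_foreach[where c = "\<lambda>_. 5" and I = "\<lambda>T' tab'.
     entry tab' = (\<lambda>b q. entry tab b q + (\<Sum>(p, a, k)\<in>T'. if q = p \<and> b = a then k else 0)) \<and>
     keys tab' = key_of ` T' \<union> keys tab \<and> dom tab' = fst ` keys tab'"])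
  fix R x and tab' :: "('q, 'a, 'k) sigtab"
  assume R: "R \<subseteq> T" "x \<notin> R" and I: "entry tab' = (\<lambda>b q. entry tab b q + (\<Sum>(p, a, k)\<in>R. if q = p \<and> b = a then k else 0)) \<and>
     keys tab' = key_of ` R \<union> keys tab \<and> dom tab' = fst ` keys tab'"
  have "finite R"
    using R assms finite_subset by blast
  obtain p a k where x: "x = (p, a, k)"
    by (cases x)
  show "wp ((\<lambda>(p, a, k). add_weight p a k) x tab') (\<lambda>tab'' u. (
     entry tab'' = (\<lambda>b q. entry tab b q + (\<Sum>(p, a, k)\<in>insert x R. if q = p \<and> b = a then k else 0)) \<and>
     keys tab'' = key_of ` insert x R \<union> keys tab \<and> dom tab'' = fst ` keys tab'') \<and> u \<le> 5)"
    unfolding x prod.case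
    by (rule wp_mono[OF wp_add_weight])
      (use I R \<open>finite R\<close> x in \<open>auto simp: fun_eq_iff key_of_def add_ac\<close>)
qed (use assms in auto)

text \<open>\<open>class_of\<close> and \<open>members\<close> describe the same partition twice.
  Keeping every number in use, also those in the queue, below \<open>next_class\<close> makes new
  numbers fresh and the queue finite.\<close>

definition valid_store :: "('q, 'a, 'k::zero) automaton \<Rightarrow> ('q, 'a, 'k) store \<Rightarrow> bool" where
  "valid_store A s \<longleftrightarrow>
     (\<forall>x\<in>aug_states A. preds s x = {(p, a, k). p \<in> aug_states A \<and> k = aug_weight A p a x \<and> k \<noteq> 0}) \<and>
     (\<forall>C. members s C = {x \<in> aug_states A. class_of s x = C}) \<and>
     (\<forall>x\<in>aug_states A. class_of s x < next_class s) \<and>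
     queue s \<subseteq> {..<next_class s}"

lemma valid_store_members: "valid_store A s \<Longrightarrow> members s C = {x \<in> aug_states A. class_of s x = C}"
  by (simp add: valid_store_def)

lemma valid_store_preds: "valid_store A s \<Longrightarrow> x \<in> aug_states A \<Longrightarrow>
   preds s x = {(p, a, k). p \<in> aug_states A \<and> k = aug_weight A p a x \<and> k \<noteq> 0}"
  by (simp add: valid_store_def)

lemma finite_preds:
  fixes s :: "('q, 'a::finite, 'k::zero) store"
  assumes "valid_store A s" "finite (states A)" "x \<in> aug_states A"
  shows "finite (preds s x)"
proof (rule finite_subset)
  show "preds s x \<subseteq> (\<lambda>(p, a). (p, a, aug_weight A p a x)) ` (aug_states A \<times> UNIV)"
    using assms by (auto simp: valid_store_preds)
qed (use assms in auto)

text \<open>At most one stored triple has a given source and letter, and where none is stored the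
  weight is zero.\<close>

lemma sum_preds:
  fixes s :: "('q, 'a::finite, 'k::semiring_0) store"
  assumes "valid_store A s" "finite (states A)" "x \<in> aug_states A" "q \<in> aug_states A"
  shows "(\<Sum>(p, a, k)\<in>preds s x. if q = p \<and> b = a then k else 0) = aug_weight A q b x"
proof -
  have "(\<Sum>(p, a, k)\<in>preds s x. if q = p \<and> b = a then k else 0)
      = (\<Sum>y\<in>preds s x. if y = (q, b, aug_weight A q b x) then aug_weight A q b x else 0)"
    using assms by (intro sum.cong) (auto simp: valid_store_preds split: if_splits)
  also have "\<dots> = (if (q, b, aug_weight A q b x) \<in> preds s x then aug_weight A q b x else 0)"
    using finite_preds[OF assms(1-3)] by (rule sum.delta)
  finally show ?thesis
    using assms by (auto simp: valid_store_preds)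
qed

text \<open>Several transitions may fall on one entry, hence only an inequality for the number of
  keys. States without any entry are covered too: their signature is a sum of zeros.\<close>

lemma wp_compute_signatures:
  fixes A :: "('q, 'a::finite, 'k::semiring_0) automaton"
  assumes v: "valid_store A s" and fin: "finite (states A)"
  shows "wp (compute_signatures D s) (\<lambda>tab t.
     t \<le> 1 + 6 * (\<Sum>x\<in>members s D. 1 + card (preds s x)) \<and>
     (\<forall>a. \<forall>p\<in>aug_states A. entry tab a p = signature A p (members s D) a) \<and>
     keys tab \<subseteq> UNIV \<times> aug_states A \<and> card (keys tab) \<le> (\<Sum>x\<in>members s D. card (preds s x)) \<and>
     dom tab = fst ` keys tab)"
proof -
  have m: "members s D \<subseteq> aug_states A"
    using v by (auto simp: valid_store_members)
  then have finm: "finite (members s D)"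
    using fin finite_subset by fastforce
  have finp: "finite (preds s x)" if "x \<in> members s D" for x
    using finite_preds[OF v fin] that m by blast
  show ?thesis
    unfolding compute_signatures_def
  proof (rule wp_foreach[where c = "\<lambda>x. 1 + 6 * card (preds s x)" and I = "\<lambda>R tab.
       (\<forall>a. \<forall>p\<in>aug_states A. entry tab a p = (\<Sum>x\<in>R. aug_weight A p a x)) \<and>
       keys tab = (\<Union>x\<in>R. key_of ` preds s x) \<and> dom tab = fst ` keys tab"])
    fix R x and tab :: "('q, 'a, 'k) sigtab"
    assume R: "R \<subseteq> members s D" "x \<in> members s D" "x \<notin> R"
      and I: "(\<forall>a. \<forall>p\<in>aug_states A. entry tab a p = (\<Sum>x\<in>R. aug_weight A p a x)) \<and>
       keys tab = (\<Union>x\<in>R. key_of ` preds s x) \<and> dom tab = fst ` keys tab"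
    have "finite R" "x \<in> aug_states A"
      using R finm m finite_subset by blast+
    show "wp (foreach (preds s x) (\<lambda>(p, a, k). add_weight p a k) tab) (\<lambda>tab u.
       ((\<forall>a. \<forall>p\<in>aug_states A. entry tab a p = (\<Sum>x\<in>insert x R. aug_weight A p a x)) \<and>
       keys tab = (\<Union>x\<in>insert x R. key_of ` preds s x) \<and> dom tab = fst ` keys tab)
       \<and> u \<le> 1 + 6 * card (preds s x))"
      by (rule wp_mono[OF wp_add_weights])
        (use finp R I \<open>finite R\<close> \<open>x \<in> aug_states A\<close> sum_preds[OF v fin] in \<open>simp_all add: add_ac\<close>)
  next
    fix tab :: "('q, 'a, 'k) sigtab" and t
    assume I: "(\<forall>a. \<forall>p\<in>aug_states A. entry tab a p = (\<Sum>x\<in>members s D. aug_weight A p a x)) \<and>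
       keys tab = (\<Union>x\<in>members s D. key_of ` preds s x) \<and> dom tab = fst ` keys tab"
      and t: "t \<le> 1 + (\<Sum>x\<in>members s D. 1 + (1 + 6 * card (preds s x)))"
    \<comment> \<open>The cost \<open>2 + 6 * card\<close> of a state is relaxed to
      \<open>6 * (1 + card)\<close>, a multiple of the weight that the potential will use.\<close>
    have "t \<le> 1 + 6 * (\<Sum>x\<in>members s D. 1 + card (preds s x))"
      unfolding sum_distrib_left by (rule order.trans[OF t]) (auto intro!: sum_mono)
    moreover have "card (keys tab) \<le> (\<Sum>x\<in>members s D. card (key_of ` preds s x))"
      using I card_UN_le[OF finm] by metis
    moreover have "\<dots> \<le> (\<Sum>x\<in>members s D. card (preds s x))"
      using finp by (intro sum_mono card_image_le)
    moreover have "keys tab \<subseteq> UNIV \<times> aug_states A"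
      using I m by (auto simp: key_of_def valid_store_preds[OF v] subset_iff)
    ultimately show "t \<le> 1 + 6 * (\<Sum>x\<in>members s D. 1 + card (preds s x)) \<and>
       (\<forall>a. \<forall>p\<in>aug_states A. entry tab a p = signature A p (members s D) a) \<and>
       keys tab \<subseteq> UNIV \<times> aug_states A \<and> card (keys tab) \<le> (\<Sum>x\<in>members s D. card (preds s x)) \<and>
       dom tab = fst ` keys tab"
      using I unfolding signature_def by auto
  qed (use finm in \<open>auto simp: entry_def keys_def\<close>)
qed

section \<open>Weak sort\<close>

definition bucket :: "('q, 'a, 'k) buckets \<Rightarrow> 'q astate \<Rightarrow> nat" where
  "bucket bs p = (case bucket_of bs p of None \<Rightarrow> 0 | Some g \<Rightarrow> g)"

text \<open>
  \<open>sem g\<close> is the signature prefix shared by the states that are sent to bucket \<open>g\<close>, where \<open>B\<close> is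
  the set of letters that were already treated.
\<close>

definition sorted_upto ::
  "('a option \<Rightarrow> 'q astate \<Rightarrow> 'k::zero) \<Rightarrow> 'a option set \<Rightarrow> (nat \<Rightarrow> 'a option \<Rightarrow> 'k)
     \<Rightarrow> ('q, 'a, 'k) buckets \<Rightarrow> bool" where
  "sorted_upto f B sem bs \<longleftrightarrow>
     0 < next_bucket bs \<and> sem 0 = (\<lambda>_. 0) \<and> inj_on sem {..<next_bucket bs} \<and>
     (\<forall>h<next_bucket bs. \<forall>b. b \<notin> B \<longrightarrow> sem h b = 0) \<and>
     (\<forall>g b k. b \<notin> B \<longrightarrow> bucket_key bs (g, b, k) = None) \<and>
     (\<forall>p. bucket_of bs p \<noteq> Some 0 \<and> bucket bs p < next_bucket bs \<and>
        sem (bucket bs p) = (\<lambda>b. if b \<in> B then f b p else 0))"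

text \<open>
  The letter \<open>a\<close> is being treated, the states in \<open>R\<close> have been moved, and the buckets from \<open>n\<close> on
  have been created for this letter.
\<close>

definition sorting ::
  "('a option \<Rightarrow> 'q astate \<Rightarrow> 'k::zero) \<Rightarrow> 'a option set \<Rightarrow> 'a option \<Rightarrow> nat \<Rightarrow> 'q astate set
     \<Rightarrow> (nat \<Rightarrow> 'a option \<Rightarrow> 'k) \<Rightarrow> ('q, 'a, 'k) buckets \<Rightarrow> bool" where
  "sorting f B a n R sem bs \<longleftrightarrow>
     0 < n \<and> n \<le> next_bucket bs \<and> sem 0 = (\<lambda>_. 0) \<and> inj_on sem {..<next_bucket bs} \<and>
     (\<forall>h<next_bucket bs. \<forall>b. b \<notin> insert a B \<longrightarrow> sem h b = 0) \<and>
     (\<forall>g b k. b \<notin> insert a B \<longrightarrow> bucket_key bs (g, b, k) = None) \<and>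
     (\<forall>h<n. sem h a = 0) \<and>
     (\<forall>g k h. bucket_key bs (g, a, k) = Some h \<longrightarrow>
        h < next_bucket bs \<and> g < n \<and> k \<noteq> 0 \<and> sem h = (sem g)(a := k)) \<and>
     (\<forall>h. n \<le> h \<and> h < next_bucket bs \<longrightarrow> (\<exists>g k. bucket_key bs (g, a, k) = Some h)) \<and>
     (\<forall>p. bucket_of bs p \<noteq> Some 0 \<and> bucket bs p < next_bucket bs \<and>
        sem (bucket bs p) = (\<lambda>b. if b \<in> B \<or> b = a \<and> p \<in> R then f b p else 0))"

lemma sorting_skip:
  assumes "sorting f B a n R sem bs" "f a p = 0"
  shows "sorting f B a n (insert p R) sem bs"
  using assms unfolding sorting_def by (auto simp: fun_eq_iff)

text \<open>An untreated state still has the value 0 at \<open>a\<close> in its prefix, while every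
  bucket created for \<open>a\<close> has a nonzero value there.\<close>

lemma sorting_bucket_less:
  assumes "sorting f B a n R sem bs" "p \<notin> R" "a \<notin> B"
  shows "bucket bs p < n" "sem (bucket bs p) a = 0"
proof -
  show 0: "sem (bucket bs p) a = 0"
    using assms by (simp add: sorting_def)
  show "bucket bs p < n"
  proof (rule ccontr)
    assume "\<not> bucket bs p < n"
    then obtain g k where "bucket_key bs (g, a, k) = Some (bucket bs p)"
      using assms(1) unfolding sorting_def by (meson not_le)
    then have "k \<noteq> 0" "sem (bucket bs p) = (sem g)(a := k)"
      using assms(1) unfolding sorting_def by blast+
    with 0 show False
      by simp
  qed
qed

lemma sorting_move:
  assumes s: "sorting f B a n R sem bs" and "p \<notin> R" "a \<notin> B" "f a p \<noteq> 0"
    and key: "bucket_key bs (bucket bs p, a, f a p) = Some h"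
  shows "sorting f B a n (insert p R) sem (bs\<lparr>bucket_of := (bucket_of bs)(p \<mapsto> h)\<rparr>)"
proof -
  have h: "h < next_bucket bs" "sem h = (sem (bucket bs p))(a := f a p)"
    using s key unfolding sorting_def by blast+
  \<comment> \<open>Bucket 0 stands for the zero prefix, but \<open>sem h\<close> has the nonzero
    value \<open>f a p\<close> at \<open>a\<close>.\<close>
  have "h \<noteq> 0"
    using s h(2) \<open>f a p \<noteq> 0\<close> unfolding sorting_def by (metis fun_upd_same)
  let ?bs = "bs\<lparr>bucket_of := (bucket_of bs)(p \<mapsto> h)\<rparr>"
  have b: "bucket ?bs q = (if q = p then h else bucket bs q)" for q
    by (simp add: bucket_def)
  have "sem (bucket ?bs q) = (\<lambda>b. if b \<in> B \<or> b = a \<and> q \<in> insert p R then f b q else 0)" for q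
    using s \<open>p \<notin> R\<close> \<open>a \<notin> B\<close> unfolding b h(2) sorting_def by (auto simp: fun_eq_iff h(2))
  moreover have "bucket_of ?bs q \<noteq> Some 0 \<and> bucket ?bs q < next_bucket ?bs" for q
    using s h(1) \<open>h \<noteq> 0\<close> unfolding b sorting_def by auto
  ultimately show ?thesis
    using s unfolding sorting_def by simp
qed

text \<open>The point is that the new prefix is not yet represented. A bucket with the same prefix
  would be nonzero at \<open>a\<close>, hence created for \<open>a\<close> from some key
  \<open>(g', a, k)\<close>. Erasing the value at \<open>a\<close> shows that \<open>g'\<close> has
  the same prefix as the current bucket, so the two are equal by injectivity, which contradicts the
  failed lookup.\<close>

lemma sorting_new:
  assumes s: "sorting f B a n R sem bs" and "p \<notin> R" "a \<notin> B" "f a p \<noteq> 0"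
    and key: "bucket_key bs (bucket bs p, a, f a p) = None"
  shows "sorting f B a n R (sem(next_bucket bs := (sem (bucket bs p))(a := f a p)))
     (bs\<lparr>next_bucket := Suc (next_bucket bs),
         bucket_key := (bucket_key bs)((bucket bs p, a, f a p) \<mapsto> next_bucket bs)\<rparr>)"
proof -
  let ?g = "bucket bs p" and ?N = "next_bucket bs"
  let ?sem = "sem(?N := (sem ?g)(a := f a p))"
  have g: "?g < n" "sem ?g a = 0"
    using sorting_bucket_less[OF s \<open>p \<notin> R\<close> \<open>a \<notin> B\<close>] .
  have n: "0 < n" "n \<le> ?N"
    using s unfolding sorting_def by blast+
  have inj: "inj_on sem {..<?N}"
    using s unfolding sorting_def by blast
  have "sem h \<noteq> (sem ?g)(a := f a p)" if "h < ?N" for h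
  proof
    assume eq: "sem h = (sem ?g)(a := f a p)"
    have "n \<le> h"
      using s eq \<open>f a p \<noteq> 0\<close> unfolding sorting_def by (metis fun_upd_same not_le)
    then obtain g' k where k: "bucket_key bs (g', a, k) = Some h"
      using s \<open>h < ?N\<close> unfolding sorting_def by blast
    then have *: "sem h = (sem g')(a := k)" "g' < n"
      using s unfolding sorting_def by blast+
    then have "sem g' a = 0"
      using s unfolding sorting_def by blast
    then have "sem g' = sem ?g" "k = f a p"
      using * eq g(2) by (metis fun_upd_idem fun_upd_upd, metis fun_upd_same)
    then have "g' = ?g"
      using inj_onD[OF inj] g(1) n * by fastforce
    with k key \<open>k = f a p\<close> show False
      by simp
  qed
  then have "inj_on ?sem {..<Suc ?N}"
    using inj by (auto simp: lessThan_Suc inj_on_def) metis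
  moreover have "\<forall>h<Suc ?N. \<forall>b. b \<notin> insert a B \<longrightarrow> ?sem h b = 0"
    using s g(1) n unfolding sorting_def less_Suc_eq by auto
  moreover have "\<forall>h<n. ?sem h a = 0"
    using s n unfolding sorting_def by auto
  moreover have "\<forall>g k h. ((bucket_key bs)((?g, a, f a p) \<mapsto> ?N)) (g, a, k) = Some h \<longrightarrow>
        h < Suc ?N \<and> g < n \<and> k \<noteq> 0 \<and> ?sem h = (?sem g)(a := k)"
  proof (intro allI impI)
    fix g k h
    assume *: "((bucket_key bs)((?g, a, f a p) \<mapsto> ?N)) (g, a, k) = Some h"
    show "h < Suc ?N \<and> g < n \<and> k \<noteq> 0 \<and> ?sem h = (?sem g)(a := k)"
    proof (cases "g = ?g \<and> k = f a p")
      case True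
      then show ?thesis
        using * g n \<open>f a p \<noteq> 0\<close> by auto
    next
      case False
      then have "bucket_key bs (g, a, k) = Some h"
        using * by (auto split: if_splits)
      then have "h < ?N \<and> g < n \<and> k \<noteq> 0 \<and> sem h = (sem g)(a := k)"
        using s unfolding sorting_def by blast
      then show ?thesis
        using n by auto
    qed
  qed
  moreover have "\<forall>h. n \<le> h \<and> h < Suc ?N \<longrightarrow>
       (\<exists>g k. ((bucket_key bs)((?g, a, f a p) \<mapsto> ?N)) (g, a, k) = Some h)"
  proof (intro allI impI)
    fix h
    assume h: "n \<le> h \<and> h < Suc ?N"
    show "\<exists>g k. ((bucket_key bs)((?g, a, f a p) \<mapsto> ?N)) (g, a, k) = Some h"
    proof (cases "h = ?N")
      case False
      then obtain g k where "bucket_key bs (g, a, k) = Some h"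
        using h s unfolding sorting_def by (metis less_SucE)
      then show ?thesis
        using key by (intro exI[of _ g] exI[of _ k]) auto
    qed (auto intro!: exI[of _ ?g])
  qed
  moreover have "\<forall>q. bucket_of bs q \<noteq> Some 0 \<and> bucket bs q < Suc ?N \<and>
      ?sem (bucket bs q) = (\<lambda>b. if b \<in> B \<or> b = a \<and> q \<in> R then f b q else 0)"
  proof
    fix q
    have "bucket_of bs q \<noteq> Some 0 \<and> bucket bs q < ?N \<and>
        sem (bucket bs q) = (\<lambda>b. if b \<in> B \<or> b = a \<and> q \<in> R then f b q else 0)"
      using s unfolding sorting_def by blast
    then show "bucket_of bs q \<noteq> Some 0 \<and> bucket bs q < Suc ?N \<and>
        ?sem (bucket bs q) = (\<lambda>b. if b \<in> B \<or> b = a \<and> q \<in> R then f b q else 0)"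
      by simp
  qed
  moreover have "\<forall>g b k. b \<notin> insert a B \<longrightarrow> ((bucket_key bs)((?g, a, f a p) \<mapsto> ?N)) (g, b, k) = None"
    using s unfolding sorting_def by auto
  moreover have "?sem 0 = (\<lambda>_. 0)"
    using s n unfolding sorting_def by auto
  moreover have "bucket (bs\<lparr>next_bucket := m, bucket_key := K\<rparr>) q = bucket bs q" for m K q
    by (simp add: bucket_def)
  ultimately show ?thesis
    using n unfolding sorting_def by (simp del: fun_upd_apply)
qed

text \<open>The eight operations are those of the branch that creates a bucket; this branch is
  analysed as an allocation followed by a move into an existing bucket.\<close>

lemma wp_place:
  fixes row :: "'q astate \<rightharpoonup> 'k::semiring_0"
  assumes s: "sorting f B a n R sem bs" and "p \<notin> R" "a \<notin> B" "row p = Some (f a p)"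
  shows "wp (place a row p bs) (\<lambda>bs' t. (\<exists>sem. sorting f B a n (insert p R) sem bs') \<and> t \<le> 8)"
proof -
  let ?g = "bucket bs p"
  have key: "\<exists>sem. sorting f B a n (insert p R) sem (bs\<lparr>bucket_of := (bucket_of bs)(p \<mapsto> h)\<rparr>)"
    if "f a p \<noteq> 0" "bucket_key bs (?g, a, f a p) = Some h" for h
    using sorting_move[OF s \<open>p \<notin> R\<close> \<open>a \<notin> B\<close> that] by blast
  have new: "\<exists>sem. sorting f B a n (insert p R) sem (bs\<lparr>next_bucket := Suc (next_bucket bs),
         bucket_key := (bucket_key bs)((?g, a, f a p) \<mapsto> next_bucket bs),
         bucket_of := (bucket_of bs)(p \<mapsto> next_bucket bs)\<rparr>)"
    if "f a p \<noteq> 0" "bucket_key bs (?g, a, f a p) = None"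
    using sorting_move[OF sorting_new[OF s \<open>p \<notin> R\<close> \<open>a \<notin> B\<close> that] \<open>p \<notin> R\<close> \<open>a \<notin> B\<close> that(1),
        of "next_bucket bs"]
    by (auto simp: bucket_def)
  have skip: "\<exists>sem. sorting f B a n (insert p R) sem bs" if "f a p = 0"
    using sorting_skip[OF s that] by blast
  show ?thesis
    using skip key new assms(4) unfolding place_def by (auto simp: bucket_def[symmetric] split: option.split)
qed

lemma wp_weak_sort:
  fixes tab :: "('q, 'a, 'k::semiring_0) sigtab"
  assumes fin: "finite (keys tab)" and dom: "dom tab = fst ` keys tab"
  shows "wp (weak_sort tab) (\<lambda>grp t. t \<le> 2 + 12 * card (keys tab) \<and>
     dom grp = {p. \<exists>a. entry tab a p \<noteq> 0} \<and>
     (\<forall>p\<in>dom grp. \<forall>q\<in>dom grp. grp p = grp q \<longleftrightarrow> (\<forall>a. entry tab a p = entry tab a q)))"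
proof -
  let ?row = "\<lambda>a. the (tab a)"
  let ?c = "\<lambda>a. 2 + 9 * card (dom (?row a))"
  have sigma: "keys tab = (SIGMA a:dom tab. dom (?row a))"
    by (auto simp: keys_def)
  have fin_dom: "finite (dom tab)"
    using fin dom by simp
  have fin_row: "finite (dom (?row a))" if "a \<in> dom tab" for a
  proof (rule finite_subset)
    show "dom (?row a) \<subseteq> snd ` keys tab"
      using that by (force simp: keys_def image_iff)
  qed (use fin in simp)
  \<comment> \<open>No row is empty, so the 3 operations per row can be charged to its entries, on
    top of the 9 per entry: this gives 12.\<close>
  have "card (dom tab) \<le> card (keys tab)"
    unfolding dom using fin by (rule card_image_le)
  moreover have "card (keys tab) = (\<Sum>a\<in>dom tab. card (dom (?row a)))"
    unfolding sigma using fin_dom fin_row by simp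
  ultimately have cost: "1 + (\<Sum>a\<in>dom tab. 1 + ?c a) \<le> 1 + 12 * card (keys tab)"
    by (simp only: sum.distrib sum_distrib_left[symmetric] sum_constant) simp
  show ?thesis
    unfolding weak_sort_def wp_bind_op1
  proof (rule wp_bind, rule wp_foreach[where c = ?c and I = "\<lambda>B bs. \<exists>sem. sorted_upto (entry tab) B sem bs"])
    show "\<exists>sem. sorted_upto (entry tab) {} sem
        \<lparr>bucket_of = Map.empty, bucket_key = Map.empty, next_bucket = 1\<rparr>"
      by (auto simp: sorted_upto_def bucket_def inj_on_def intro!: exI[of _ "\<lambda>_ _. 0"])
  next
    fix B a and bs :: "('q, 'a, 'k) buckets"
    assume B: "B \<subseteq> dom tab" "a \<in> dom tab" "a \<notin> B" and "\<exists>sem. sorted_upto (entry tab) B sem bs"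
    then obtain sem where s: "sorted_upto (entry tab) B sem bs"
      by blast
    let ?n = "next_bucket bs"
    have "wp (foreach (dom (?row a)) (place a (?row a)) bs)
       (\<lambda>bs t. (\<exists>sem. sorted_upto (entry tab) (insert a B) sem bs) \<and> t \<le> 1 + 9 * card (dom (?row a)))"
    proof (rule wp_foreach[where c = "\<lambda>_. 8" and I = "\<lambda>R bs. \<exists>sem. sorting (entry tab) B a ?n R sem bs"])
      \<comment> \<open>At this moment no bucket has been created for \<open>a\<close>, and all
        prefixes vanish at \<open>a\<close>.\<close>
      show "\<exists>sem. sorting (entry tab) B a ?n {} sem bs"
        using s B(3) unfolding sorted_upto_def sorting_def by (intro exI[of _ sem]) auto
    next
      fix R p and bs :: "('q, 'a, 'k) buckets"
      assume "p \<in> dom (?row a)" "p \<notin> R" "\<exists>sem. sorting (entry tab) B a ?n R sem bs"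
      then show "wp (place a (?row a) p bs)
          (\<lambda>bs t. (\<exists>sem. sorting (entry tab) B a ?n (insert p R) sem bs) \<and> t \<le> 8)"
        using wp_place[of "entry tab" B a ?n R _ bs p "?row a"] B by (auto simp: entry_def)
    next
      fix bs' :: "('q, 'a, 'k) buckets" and t :: nat
      assume "\<exists>sem. sorting (entry tab) B a ?n (dom (?row a)) sem bs'"
      then obtain sem where s: "sorting (entry tab) B a ?n (dom (?row a)) sem bs'"
        by blast
      \<comment> \<open>States outside the row are never visited; their prefix keeps the value 0 at
        \<open>a\<close>, which is the correct one.\<close>
      have 0: "p \<notin> dom (?row a) \<Longrightarrow> entry tab a p = 0" for p
        using B(2) by (auto simp: entry_def dom_def split: option.splits)
      have "(if b \<in> B \<or> b = a \<and> p \<in> dom (?row a) then entry tab b p else 0) =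
         (if b \<in> insert a B then entry tab b p else 0)" for b p
        using 0[of p] by auto
      with s have "sorted_upto (entry tab) (insert a B) sem bs'"
        unfolding sorting_def sorted_upto_def by simp
      moreover assume "t \<le> 1 + (\<Sum>x\<in>dom (?row a). 1 + 8)"
      ultimately show "(\<exists>sem. sorted_upto (entry tab) (insert a B) sem bs') \<and> t \<le> 1 + 9 * card (dom (?row a))"
        by auto
    qed (use fin_row B in auto)
    then show "wp (bind_prog (op1 (?row a)) (\<lambda>row. foreach (dom row) (place a row) bs))
       (\<lambda>bs' u. (\<exists>sem. sorted_upto (entry tab) (insert a B) sem bs') \<and> u \<le> ?c a)"
      by (auto elim: wp_mono)
  next
    fix bs :: "('q, 'a, 'k) buckets" and t :: nat
    assume "\<exists>sem. sorted_upto (entry tab) (dom tab) sem bs"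
    then obtain sem where s: "sorted_upto (entry tab) (dom tab) sem bs"
      by blast
    have "(if b \<in> dom tab then entry tab b p else 0) = entry tab b p" for b p
      by (auto simp: entry_def dom_def)
    then have sem: "sem (bucket bs p) = (\<lambda>b. entry tab b p)" "bucket bs p < next_bucket bs" for p
      using s by (simp_all add: sorted_upto_def)
    have inj: "g = h" if "sem g = sem h" "g < next_bucket bs" "h < next_bucket bs" for g h
      using s that unfolding sorted_upto_def inj_on_def by blast
    have zero: "sem 0 = (\<lambda>_. 0)" "0 < next_bucket bs"
      using s unfolding sorted_upto_def by blast+
    \<comment> \<open>\<open>bucket_of\<close> never stores 0, and by injectivity bucket 0 is the
      only one with the zero prefix.\<close>
    have none: "bucket_of bs p = None \<longleftrightarrow> (\<forall>a. entry tab a p = 0)" for p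
    proof -
      have "bucket_of bs p = None \<longleftrightarrow> bucket bs p = 0"
        using s by (auto simp: bucket_def sorted_upto_def split: option.splits)
      also have "\<dots> \<longleftrightarrow> sem (bucket bs p) = sem 0"
        using inj[of "bucket bs p" 0] sem(2) zero(2) by metis
      finally show ?thesis
        unfolding sem(1) zero(1) by (simp add: fun_eq_iff)
    qed
    have "bucket_of bs p = bucket_of bs q \<longleftrightarrow> (\<forall>a. entry tab a p = entry tab a q)"
      if "p \<in> dom (bucket_of bs)" "q \<in> dom (bucket_of bs)" for p q
    proof -
      have "bucket_of bs p = bucket_of bs q \<longleftrightarrow> bucket bs p = bucket bs q"
        using that by (auto simp: bucket_def)
      also have "\<dots> \<longleftrightarrow> sem (bucket bs p) = sem (bucket bs q)"
        using inj sem by metis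
      finally show ?thesis
        by (simp add: sem fun_eq_iff)
    qed
    moreover assume "t \<le> 1 + (\<Sum>a\<in>dom tab. 1 + ?c a)"
    moreover have "dom (bucket_of bs) = {p. \<exists>a. entry tab a p \<noteq> 0}"
      by (simp add: dom_def none)
    ultimately show "wp (ret (bucket_of bs)) (\<lambda>grp u. Suc (t + u) \<le> 2 + 12 * card (keys tab) \<and>
     dom grp = {p. \<exists>a. entry tab a p \<noteq> 0} \<and>
     (\<forall>p\<in>dom grp. \<forall>q\<in>dom grp. grp p = grp q \<longleftrightarrow> (\<forall>a. entry tab a p = entry tab a q)))"
      using cost by simp
  qed (rule fin_dom)
qed

section \<open>Splitting the classes\<close>

text \<open>
  The states in \<open>R\<close> have left their classes; the subclasses of the states in \<open>R'\<close> exist already.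
\<close>

definition splitting ::
  "('q, 'a, 'k) automaton \<Rightarrow> ('q, 'a, 'k) store \<Rightarrow> ('q astate \<rightharpoonup> nat) \<Rightarrow> 'q astate set \<Rightarrow> 'q astate set
     \<Rightarrow> ('q, 'a, 'k) split_state \<Rightarrow> bool" where
  "splitting A s grp R R' w \<longleftrightarrow>
     preds (st w) = preds s \<and> queue (st w) = queue s \<and> next_class s \<le> next_class (st w) \<and>
     (\<forall>p. class_of (st w) p =
        (if p \<in> R then the (part_at w (class_of s p, the (grp p))) else class_of s p)) \<and>
     (\<forall>C. members (st w) C = {x \<in> aug_states A. class_of (st w) x = C}) \<and>
     dom (part_at w) = (\<lambda>p. (class_of s p, the (grp p))) ` R' \<and>
     ran (part_at w) = {next_class s..<next_class (st w)} \<and>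
     inj_on (part_at w) (dom (part_at w)) \<and>
     (\<forall>C. parts w C = (if C \<in> class_of s ` R' then Some {N. \<exists>g. part_at w (C, g) = Some N} else None))"

text \<open>The subclass is allocated before the state enters it; this intermediate moment is the
  reason for having two sets of states in \<open>splitting\<close>.\<close>

lemma wp_find_subclass:
  assumes s: "splitting A s grp R R w" and C: "C = class_of s p" and g: "g = the (grp p)"
  shows "wp (find_subclass C g w) (\<lambda>(N, w') t.
     t \<le> 6 \<and> splitting A s grp R (insert p R) w' \<and> part_at w' (C, g) = Some N)"
proof -
  let ?N = "next_class (st w)"
  let ?w = "w\<lparr>st := st w\<lparr>next_class := Suc ?N\<rparr>, part_at := (part_at w)((C, g) \<mapsto> ?N),
      parts := (parts w)(C \<mapsto> insert ?N (case parts w C of None \<Rightarrow> {} | Some Ns \<Rightarrow> Ns))\<rparr>"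
  \<comment> \<open>An existing key was produced by a state already in \<open>R\<close>, so adding
    \<open>p\<close> changes neither the keys nor the touched classes.\<close>
  have old: "splitting A s grp R (insert p R) w" if "part_at w (C, g) = Some N" for N
  proof -
    have "(C, g) \<in> (\<lambda>p. (class_of s p, the (grp p))) ` R"
      using s domI[of "part_at w", OF that] unfolding splitting_def by blast
    then have "(\<lambda>p. (class_of s p, the (grp p))) ` insert p R = (\<lambda>p. (class_of s p, the (grp p))) ` R"
      "class_of s ` insert p R = class_of s ` R"
      unfolding C g by auto
    note eqs = this
    show ?thesis
      using s unfolding splitting_def eqs .
  qed
  have new: "splitting A s grp R (insert p R) ?w" if none: "part_at w (C, g) = None"
  proof -
    have fresh: "(C, g) \<notin> (\<lambda>p. (class_of s p, the (grp p))) ` R"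
      using s domIff[of "(C, g)" "part_at w"] none unfolding splitting_def by simp
    have ran: "ran (part_at w) = {next_class s..<?N}" and le: "next_class s \<le> ?N"
      and inj: "inj_on (part_at w) (dom (part_at w))"
      using s unfolding splitting_def by blast+
    have ran': "ran (part_at ?w) = {next_class s..<Suc ?N}"
      using none ran le by (simp add: atLeastLessThanSuc)
    have "part_at w y \<noteq> Some ?N" for y
      using ranI[of "part_at w" y ?N] ran by auto
    then have inj': "inj_on (part_at ?w) (dom (part_at ?w))"
      using inj none by (auto simp: inj_on_def dom_def)
    have parts: "parts ?w C' = (if C' \<in> class_of s ` insert p R
        then Some {N. \<exists>g. part_at ?w (C', g) = Some N} else None)" for C'
    proof (cases "C' = C")
      case True
      \<comment> \<open>An untouched class has no subclass, which justifies reading a missing entry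
        of \<open>parts\<close> as the empty set.\<close>
      have empty: "part_at w (C, g) = None" if "C \<notin> class_of s ` R" for g
      proof (rule ccontr)
        assume "part_at w (C, g) \<noteq> None"
        then have "(C, g) \<in> (\<lambda>p. (class_of s p, the (grp p))) ` R"
          using s unfolding splitting_def by blast
        with that show False
          by blast
      qed
      have p: "parts w C = (if C \<in> class_of s ` R then Some {N. \<exists>g. part_at w (C, g) = Some N} else None)"
        using s unfolding splitting_def by blast
      have "{N. \<exists>g'. part_at ?w (C, g') = Some N} = insert ?N {N. \<exists>g'. part_at w (C, g') = Some N}"
        using none by auto (metis option.distinct(1))
      moreover have "(case parts w C of None \<Rightarrow> {} | Some Ns \<Rightarrow> Ns) = {N. \<exists>g. part_at w (C, g) = Some N}"
        using empty by (cases "C \<in> class_of s ` R") (simp_all add: p)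
      ultimately show ?thesis
        using True C by (simp add: fun_upd_same del: fun_upd_apply)
    next
      case False
      then show ?thesis
        using s C by (simp add: splitting_def)
    qed
    show ?thesis
      unfolding splitting_def
    proof (intro conjI allI)
      show "class_of (st ?w) q =
        (if q \<in> R then the (part_at ?w (class_of s q, the (grp q))) else class_of s q)" for q
        using s fresh by (auto simp: splitting_def)
      show "dom (part_at ?w) = (\<lambda>p. (class_of s p, the (grp p))) ` insert p R"
        using s C g by (simp add: splitting_def)
      show "ran (part_at ?w) = {next_class s..<next_class (st ?w)}"
        using ran' by simp
    qed (use s le parts inj' in \<open>simp_all add: splitting_def\<close>)
  qed
  show ?thesis
  proof (cases "part_at w (C, g)")
    case None
    show ?thesis
      using new[OF None] None by (simp add: find_subclass_def fun_upd_same del: fun_upd_apply)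
  next
    case (Some N)
    show ?thesis
      using old[OF Some] Some by (simp add: find_subclass_def)
  qed
qed

lemma wp_move_state:
  fixes A :: "('q, 'a, 'k) automaton"
  assumes s: "splitting A s grp R R w" and "p \<notin> R" "p \<in> aug_states A"
    and less: "class_of s p < next_class s"
  shows "wp (move_state grp p w) (\<lambda>w' t. splitting A s grp (insert p R) (insert p R) w' \<and> t \<le> 13)"
proof -
  have C: "class_of (st w) p = class_of s p"
    using s \<open>p \<notin> R\<close> by (simp add: splitting_def)
  show ?thesis
    unfolding move_state_def wp_bind_op1
  proof (rule wp_bind, rule wp_mono[OF wp_find_subclass[OF s C refl]], clarify)
    fix N and w' :: "('q, 'a, 'k) split_state" and t :: nat
    assume t: "t \<le> 6" and s': "splitting A s grp R (insert p R) w'"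
      and N: "part_at w' (class_of (st w) p, the (grp p)) = Some N"
    have "N \<in> {next_class s..<next_class (st w')}"
      using s' ranI[of "part_at w'", OF N] by (simp add: splitting_def)
    \<comment> \<open>Subclasses are numbered from \<open>next_class s\<close> on, so the deletion
      of \<open>p\<close> and its insertion concern two different lists.\<close>
    then have "N \<noteq> class_of s p"
      using less by auto
    let ?C = "class_of s p"
    let ?s = "st w'\<lparr>members := (members (st w'))(?C := members (st w') ?C - {p}),
      class_of := (class_of (st w'))(p := N)\<rparr>"
    let ?w = "w'\<lparr>st := st w'\<lparr>
      members := (members (st w'))(?C := members (st w') ?C - {p}, N := insert p (members (st w') N)),
      class_of := (class_of (st w'))(p := N)\<rparr>\<rparr>"
    have C': "class_of (st w') p = ?C"
      using s' \<open>p \<notin> R\<close> by (simp add: splitting_def)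
    have "splitting A s grp (insert p R) (insert p R) ?w"
      unfolding splitting_def
    proof (intro conjI allI)
      have "members (st w') C' = {x \<in> aug_states A. class_of (st w') x = C'}" for C'
        using s' unfolding splitting_def by blast
      then show "members (st ?w) C' = {x \<in> aug_states A. class_of (st ?w) x = C'}" for C'
        using C' \<open>N \<noteq> ?C\<close> \<open>p \<in> aug_states A\<close> by auto
      show "class_of (st ?w) q = (if q \<in> insert p R
          then the (part_at ?w (class_of s q, the (grp q))) else class_of s q)" for q
        using s' N C by (auto simp: splitting_def)
      have "inj_on (part_at w') (dom (part_at w'))"
        using s' unfolding splitting_def by blast
      then show "inj_on (part_at ?w) (dom (part_at ?w))"
        by simp
    qed (use s' in \<open>simp_all add: splitting_def\<close>)
    then show "wp (op1 (st w') \<bind>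
        (\<lambda>sa. op1 (sa\<lparr>members := (members sa)(class_of (st w) p := members sa (class_of (st w) p) - {p})\<rparr>) \<bind>
        (\<lambda>sa. op1 (sa\<lparr>members := (members sa)(N := insert p (members sa N))\<rparr>) \<bind>
        (\<lambda>sa. op1 (sa\<lparr>class_of := (class_of sa)(p := N)\<rparr>) \<bind>
        (\<lambda>sa. op1 (w'\<lparr>st := sa\<rparr>))))))
        (\<lambda>y u. splitting A s grp (insert p R) (insert p R) y \<and> Suc (Suc (t + u)) \<le> 13)"
      using t C \<open>N \<noteq> ?C\<close> by simp
  qed
qed

lemma wp_split_classes:
  fixes A :: "('q, 'a, 'k::zero) automaton"
  assumes v: "valid_store A s" and grp: "dom grp \<subseteq> aug_states A" and fin: "finite (states A)"
  shows "wp (split_classes grp s) (\<lambda>w t. splitting A s grp (dom grp) (dom grp) w \<and> t \<le> 2 + 14 * card (dom grp))"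
  unfolding split_classes_def wp_bind_op1
proof (rule wp_foreach[where c = "\<lambda>_. 13" and I = "\<lambda>R w. splitting A s grp R R w"])
  show "finite (dom grp)"
    using grp fin finite_subset by fastforce
  show "splitting A s grp {} {} \<lparr>st = s, part_at = Map.empty, parts = Map.empty\<rparr>"
    using v by (auto simp: splitting_def valid_store_def)
  fix R p and w :: "('q, 'a, 'k) split_state"
  assume "splitting A s grp R R w" "p \<notin> R" "p \<in> dom grp"
  then show "wp (move_state grp p w) (\<lambda>w' t. splitting A s grp (insert p R) (insert p R) w' \<and> t \<le> 13)"
    using v grp by (intro wp_move_state) (auto simp: valid_store_def)
qed auto

section \<open>Updating the queue\<close>

lemma wp_pick_largest:
  assumes "finite Ns" "Ns \<noteq> {}"
  shows "wp (pick_largest Ns s) (\<lambda>L t. t \<le> 2 + 2 * card Ns \<and> L \<in> Ns \<and>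
     (\<forall>N\<in>Ns. card (members s N) \<le> card (members s L)))"
  unfolding pick_largest_def
proof (rule wp_bind, rule wp_foreach[where c = "\<lambda>_. 1" and I = "\<lambda>_ _. True"])
  obtain L where "L \<in> Ns" "card (members s L) = Max ((\<lambda>N. card (members s N)) ` Ns)"
    using Max_in[of "(\<lambda>N. card (members s N)) ` Ns"] assms by fastforce
  then have "{L \<in> Ns. \<forall>N\<in>Ns. card (members s N) \<le> card (members s L)} \<noteq> {}"
    using assms by auto
  then show "wp (pick {L \<in> Ns. \<forall>N\<in>Ns. card (members s N) \<le> card (members s L)})
      (\<lambda>L u. t + u \<le> 2 + 2 * card Ns \<and> L \<in> Ns \<and> (\<forall>N\<in>Ns. card (members s N) \<le> card (members s L)))"
    if "t \<le> 1 + (\<Sum>x\<in>Ns. 1 + 1)" for t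
    using that by simp
qed (use assms in auto)

lemma wp_enqueue_all:
  assumes "finite Ns"
  shows "wp (enqueue_all Ns s) (\<lambda>s' t. t \<le> 1 + 2 * card Ns \<and> s' = s\<lparr>queue := Ns \<union> queue s\<rparr>)"
  unfolding enqueue_all_def
  by (rule wp_foreach[where c = "\<lambda>_. 1" and I = "\<lambda>R s'. s' = s\<lparr>queue := R \<union> queue s\<rparr>"])
    (use assms in auto)

text \<open>If all states of a class have the same nonzero signature, the result is a single new
  number: the class is renumbered rather than split.\<close>

definition subclasses :: "(nat \<rightharpoonup> nat set) \<Rightarrow> ('q, 'a, 'k) store \<Rightarrow> nat \<Rightarrow> nat set" where
  "subclasses prts s C = (if members s C = {} then the (prts C) else insert C (the (prts C)))"

text \<open>The new queue is compared only on \<open>C\<close> and the new numbers of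
  \<open>C\<close>. These blocks are disjoint for different \<open>C\<close>, so the property
  survives the treatment of the other classes; sizes and membership in the queue refer to the store
  before any class is treated.\<close>

definition requeued :: "(nat \<rightharpoonup> nat set) \<Rightarrow> ('q, 'a, 'k) store \<Rightarrow> nat \<Rightarrow> nat set \<Rightarrow> bool" where
  "requeued prts s C q \<longleftrightarrow>
     (let subs = subclasses prts s C; q' = q \<inter> insert C (the (prts C)) in
      if C \<in> queue s then q' = subs
      else \<exists>L\<in>subs. (\<forall>N\<in>subs. card (members s N) \<le> card (members s L)) \<and> q' = subs - {L})"

text \<open>The bound comes from the unqueued case: 4 operations, at most
  \<open>4 + 2 * card\<close> for choosing a largest subclass, 1 for dropping it and at most
  \<open>3 + 2 * card\<close> for the insertions. The old number can add one subclass to the new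
  ones.\<close>

lemma wp_requeue:
  assumes fin: "finite (the (prts C))" and ne: "the (prts C) \<noteq> {}"
    and mem: "members s' = members s"
    and q: "queue s' \<inter> insert C (the (prts C)) = queue s \<inter> {C}"
  shows "wp (requeue prts C s') (\<lambda>s'' t. t \<le> 12 + 4 * card (the (prts C)) \<and>
     (\<exists>q. s'' = s'\<lparr>queue := q\<rparr> \<and> q - insert C (the (prts C)) = queue s' - insert C (the (prts C)) \<and>
        requeued prts s C q))"
proof -
  let ?Ns = "the (prts C)" and ?subs = "subclasses prts s C"
  have subs: "finite ?subs" "?subs \<noteq> {}" "?subs \<subseteq> insert C ?Ns" "card ?subs \<le> Suc (card ?Ns)"
    using fin ne by (auto simp: subclasses_def card_insert_if)
  have queued: "C \<in> queue s' \<longleftrightarrow> C \<in> queue s"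
    using q by blast
  show ?thesis
  proof (cases "C \<in> queue s")
    case True
    have "wp (enqueue_all ?subs (s'\<lparr>queue := queue s' - {C}\<rparr>)) (\<lambda>s'' t.
      Suc (Suc (Suc (Suc (Suc t)))) \<le> 12 + 4 * card (the (prts C)) \<and>
     (\<exists>q. s'' = s'\<lparr>queue := q\<rparr> \<and> q - insert C (the (prts C)) = queue s' - insert C (the (prts C)) \<and>
        requeued prts s C q))"
    proof (rule wp_mono[OF wp_enqueue_all[OF subs(1)]], intro conjI exI)
      show "requeued prts s C (?subs \<union> (queue s' - {C}))"
        using True subs q by (auto simp: requeued_def Let_def)
    qed (use subs in auto)
    then show ?thesis
      using True queued mem by (simp add: requeue_def subclasses_def)
  next
    case False
    have "wp (pick_largest ?subs s' \<bind> (\<lambda>L. op1 (?subs - {L}) \<bind> (\<lambda>rest. enqueue_all rest s'))) (\<lambda>s'' t.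
      Suc (Suc (Suc (Suc t))) \<le> 12 + 4 * card (the (prts C)) \<and>
     (\<exists>q. s'' = s'\<lparr>queue := q\<rparr> \<and> q - insert C (the (prts C)) = queue s' - insert C (the (prts C)) \<and>
        requeued prts s C q))"
    proof (rule wp_bind, rule wp_mono[OF wp_pick_largest[OF subs(1,2)]], unfold wp_bind_op1)
      fix L and t :: nat
      assume L: "t \<le> 2 + 2 * card ?subs \<and> L \<in> ?subs \<and>
        (\<forall>N\<in>?subs. card (members s' N) \<le> card (members s' L))"
      show "wp (enqueue_all (?subs - {L}) s') (\<lambda>s'' u.
        Suc (Suc (Suc (Suc (t + Suc u)))) \<le> 12 + 4 * card (the (prts C)) \<and>
       (\<exists>q. s'' = s'\<lparr>queue := q\<rparr> \<and> q - insert C (the (prts C)) = queue s' - insert C (the (prts C)) \<and>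
          requeued prts s C q))"
      proof (rule wp_mono[OF wp_enqueue_all[OF finite_Diff[OF subs(1)]]], intro conjI exI)
        show "requeued prts s C (?subs - {L} \<union> queue s')"
          using False subs q L mem unfolding requeued_def Let_def by (auto intro!: bexI[of _ L])
        have "card (?subs - {L}) \<le> card ?subs"
          using subs by (simp add: card_Diff1_le)
        then show "Suc (Suc (Suc (Suc (t + Suc u)))) \<le> 12 + 4 * card ?Ns"
          if "u \<le> 1 + 2 * card (?subs - {L}) \<and> s'' = s'\<lparr>queue := ?subs - {L} \<union> queue s'\<rparr>" for u s''
          using conjunct1[OF L] conjunct1[OF that] subs(4) by linarith
      qed (use subs in auto)
    qed
    then show ?thesis
      using False queued mem by (simp add: requeue_def subclasses_def)
  qed
qed

lemma wp_requeue_all: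
  assumes fin: "finite (dom prts)" and prts: "\<And>C Ns. prts C = Some Ns \<Longrightarrow> finite Ns \<and> Ns \<noteq> {} \<and> Ns \<inter> queue s = {} \<and> Ns \<inter> dom prts = {}"
    and disj: "\<And>C C' Ns Ns'. prts C = Some Ns \<Longrightarrow> prts C' = Some Ns' \<Longrightarrow> C \<noteq> C' \<Longrightarrow> Ns \<inter> Ns' = {}"
  shows "wp (foreach (dom prts) (requeue prts) s) (\<lambda>s' t.
     t \<le> 1 + (\<Sum>C\<in>dom prts. 13 + 4 * card (the (prts C))) \<and>
     (\<exists>q. s' = s\<lparr>queue := q\<rparr> \<and> (\<forall>C\<in>dom prts. requeued prts s C q) \<and>
        q - (\<Union>C\<in>dom prts. insert C (the (prts C))) = queue s - (\<Union>C\<in>dom prts. insert C (the (prts C)))))"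
proof (rule wp_foreach[where c = "\<lambda>C. 12 + 4 * card (the (prts C))" and I = "\<lambda>R s'.
     \<exists>q. s' = s\<lparr>queue := q\<rparr> \<and> (\<forall>C\<in>R. requeued prts s C q) \<and>
        q - (\<Union>C\<in>R. insert C (the (prts C))) = queue s - (\<Union>C\<in>R. insert C (the (prts C)))"])
  fix R C s'
  assume R: "R \<subseteq> dom prts" "C \<in> dom prts" "C \<notin> R"
  assume "\<exists>q. s' = s\<lparr>queue := q\<rparr> \<and> (\<forall>C\<in>R. requeued prts s C q) \<and>
        q - (\<Union>C\<in>R. insert C (the (prts C))) = queue s - (\<Union>C\<in>R. insert C (the (prts C)))"
  then obtain q where q: "s' = s\<lparr>queue := q\<rparr>" "\<forall>C\<in>R. requeued prts s C q"
        "q - (\<Union>C\<in>R. insert C (the (prts C))) = queue s - (\<Union>C\<in>R. insert C (the (prts C)))"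
    by blast
  \<comment> \<open>The blocks of two classes cannot meet: new numbers differ between classes and
    are never the number of a touched class.\<close>
  have dj: "insert C (the (prts C)) \<inter> insert C' (the (prts C')) = {}" if "C' \<in> R" for C'
  proof -
    have "C' \<in> dom prts"
      using that R by blast
    then obtain Ns Ns' where "prts C = Some Ns" "prts C' = Some Ns'"
      using R(2) by blast
    moreover have "C' \<noteq> C"
      using that R by blast
    ultimately show ?thesis
      using prts[of C Ns] prts[of C' Ns'] disj[of C Ns C' Ns'] by auto
  qed
  have Ns: "finite (the (prts C))" "the (prts C) \<noteq> {}" "the (prts C) \<inter> queue s = {}"
    using prts R(2) by (auto simp: dom_def)
  have "q \<inter> insert C (the (prts C)) = queue s \<inter> insert C (the (prts C))"
    using q(3) dj by blast
  then have qC: "queue s' \<inter> insert C (the (prts C)) = queue s \<inter> {C}"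
    using Ns(3) by (auto simp: q(1))
  have mem: "members s' = members s"
    by (simp add: q(1))
  show "wp (requeue prts C s') (\<lambda>s' u. (\<exists>q. s' = s\<lparr>queue := q\<rparr> \<and> (\<forall>C\<in>insert C R. requeued prts s C q) \<and>
        q - (\<Union>C\<in>insert C R. insert C (the (prts C))) = queue s - (\<Union>C\<in>insert C R. insert C (the (prts C))))
        \<and> u \<le> 12 + 4 * card (the (prts C)))"
  proof (rule wp_mono[OF wp_requeue[where prts = prts and C = C, OF Ns(1,2) mem qC]], elim conjE exE, intro conjI exI)
    fix q' s''
    assume q': "s'' = s'\<lparr>queue := q'\<rparr>" "requeued prts s C q'"
      "q' - insert C (the (prts C)) = queue s' - insert C (the (prts C))"
    show "s'' = s\<lparr>queue := q'\<rparr>"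
      using q' q by simp
    have "requeued prts s C' q'" if "C' \<in> R" for C'
    proof -
      have "q' \<inter> insert C' (the (prts C')) = q \<inter> insert C' (the (prts C'))"
        using q'(3) dj[OF that] unfolding q(1) by auto
      then show ?thesis
        using q(2) that unfolding requeued_def by metis
    qed
    then show "\<forall>C\<in>insert C R. requeued prts s C q'"
      using q' by blast
    have Un: "X - (\<Union>C\<in>insert C R. insert C (the (prts C))) =
        X - insert C (the (prts C)) - (\<Union>C\<in>R. insert C (the (prts C)))" for X
      by blast
    show "q' - (\<Union>C\<in>insert C R. insert C (the (prts C))) = queue s - (\<Union>C\<in>insert C R. insert C (the (prts C)))"
    proof -
      let ?f = "insert C (the (prts C))" and ?U = "\<Union>C\<in>R. insert C (the (prts C))"
      have "q' - ?f - ?U = q - ?f - ?U"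
        using q'(3) q(1) by simp
      also have "\<dots> = q - ?U - ?f"
        by blast
      also have "\<dots> = queue s - ?U - ?f"
        using q(3) by simp
      also have "\<dots> = queue s - ?f - ?U"
        by blast
      finally show ?thesis
        unfolding Un .
    qed
  qed
qed (use fin in \<open>auto intro: exI[of _ "queue s"]\<close>)

text \<open>Classes are reached through their states, so a mere renumbering is invisible. The
  extracted class \<open>D\<close> counts as unqueued: if it splits itself, one largest subclass is
  left out. For a class that stays in one piece, \<open>L\<close> is its number after the round. The
  last conjunct forbids that numbers of empty classes enter the queue.\<close>

definition split_by ::
  "('q, 'a, 'k::semiring_0) automaton \<Rightarrow> ('q, 'a, 'k) store \<Rightarrow> nat \<Rightarrow> ('q, 'a, 'k) store \<Rightarrow> bool" where
  "split_by A s D s' \<longleftrightarrow>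
     valid_store A s' \<and> (\<forall>x\<in>aug_states A. preds s' x = preds s x) \<and>
     (\<forall>x\<in>aug_states A. \<forall>y\<in>aug_states A. class_of s' x = class_of s' y \<longleftrightarrow>
        class_of s x = class_of s y \<and> signature A x (members s D) = signature A y (members s D)) \<and>
     (\<forall>x\<in>aug_states A. class_of s x \<in> queue s - {D} \<longrightarrow> class_of s' x \<in> queue s') \<and>
     (\<forall>C. C \<notin> queue s - {D} \<and> members s C \<noteq> {} \<longrightarrow>
        (\<exists>L\<in>class_of s' ` members s C. L \<notin> queue s' \<and>
           (\<forall>x\<in>members s C. card (members s' (class_of s' x)) \<le> card (members s' L) \<and>
              (class_of s' x = L \<or> class_of s' x \<in> queue s')))) \<and>
     {C \<in> queue s'. members s' C = {}} \<subseteq> {C \<in> queue s. members s C = {}} - {D}"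

section \<open>Effect of one round on the partition and the queue\<close>

context
  fixes A :: "('q, 'a::finite, 'k::semiring_0) automaton" and s :: "('q, 'a, 'k) store"
    and grp :: "'q astate \<rightharpoonup> nat" and w :: "('q, 'a, 'k) split_state" and M :: "'q astate set"
  assumes v: "valid_store A s" and fin: "finite (states A)"
    and dom_grp: "dom grp = {p \<in> aug_states A. signature A p M \<noteq> (\<lambda>_. 0)}"
    and grp: "\<And>p q. p \<in> dom grp \<Longrightarrow> q \<in> dom grp \<Longrightarrow> grp p = grp q \<longleftrightarrow> signature A p M = signature A q M"
    and w: "splitting A s grp (dom grp) (dom grp) w"
begin

lemma fin_grp: "finite (dom grp)"
  unfolding dom_grp using fin by simp

lemma class_less: "x \<in> aug_states A \<Longrightarrow> class_of s x < next_class s"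
  using v unfolding valid_store_def by blast

lemma split_class: "class_of (st w) p =
    (if p \<in> dom grp then the (part_at w (class_of s p, the (grp p))) else class_of s p)"
  using w unfolding splitting_def by blast

lemma class_moved:
  assumes "p \<in> dom grp"
  shows "part_at w (class_of s p, the (grp p)) = Some (class_of (st w) p)"
    "next_class s \<le> class_of (st w) p" "class_of (st w) p < next_class (st w)"
proof -
  have "(class_of s p, the (grp p)) \<in> dom (part_at w)"
    using w assms unfolding splitting_def by blast
  then show *: "part_at w (class_of s p, the (grp p)) = Some (class_of (st w) p)"
    using assms unfolding split_class by auto
  have "ran (part_at w) = {next_class s..<next_class (st w)}"
    using w unfolding splitting_def by blast
  then show "next_class s \<le> class_of (st w) p" "class_of (st w) p < next_class (st w)"
    using ranI[of "part_at w", OF *] by auto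
qed

lemma class_unmoved: "p \<notin> dom grp \<Longrightarrow> class_of (st w) p = class_of s p"
  unfolding split_class by simp

lemma split_members: "members (st w) C = {x \<in> aug_states A. class_of (st w) x = C}"
  using w unfolding splitting_def by blast

text \<open>Moved states have nonzero signature and fresh numbers, the others zero signature and
  their old number. Among moved states, injectivity of \<open>part_at\<close> makes the new number
  encode exactly the pair of old class and bucket.\<close>

lemma split_class_eq:
  assumes "x \<in> aug_states A" "y \<in> aug_states A"
  shows "class_of (st w) x = class_of (st w) y \<longleftrightarrow>
    class_of s x = class_of s y \<and> signature A x M = signature A y M"
proof -
  have zero: "signature A x M = (\<lambda>_. 0)" if "x \<in> aug_states A" "x \<notin> dom grp" for x
    using that dom_grp by blast
  have nonzero: "signature A x M \<noteq> (\<lambda>_. 0)" if "x \<in> dom grp" for x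
    using that dom_grp by blast
  have new: "class_of (st w) x \<noteq> class_of (st w) y"
    if "x \<in> dom grp" "y \<notin> dom grp" "y \<in> aug_states A" for x y
    using class_moved(2)[OF that(1)] class_unmoved[OF that(2)] class_less[OF that(3)] by simp
  show ?thesis
  proof (cases "x \<in> dom grp"; cases "y \<in> dom grp")
    assume xy: "x \<in> dom grp" "y \<in> dom grp"
    have "inj_on (part_at w) (dom (part_at w))"
      using w unfolding splitting_def by blast
    then have "class_of (st w) x = class_of (st w) y \<longleftrightarrow>
        (class_of s x, the (grp x)) = (class_of s y, the (grp y))"
      using class_moved(1)[OF xy(1)] class_moved(1)[OF xy(2)] unfolding inj_on_def
      by (metis domI option.inject)
    also have "the (grp x) = the (grp y) \<longleftrightarrow> grp x = grp y"
      using xy by auto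
    ultimately show ?thesis
      using grp[OF xy] by auto
  next
    assume "x \<notin> dom grp" "y \<notin> dom grp"
    then show ?thesis
      using zero assms by (simp add: class_unmoved)
  next
    assume "x \<in> dom grp" "y \<notin> dom grp"
    then show ?thesis
      using zero nonzero new[of x y] assms by metis
  next
    assume "x \<notin> dom grp" "y \<in> dom grp"
    then show ?thesis
      using zero nonzero new[of y x] assms by metis
  qed
qed

lemma dom_parts: "dom (parts w) = class_of s ` dom grp"
proof -
  have "parts w C = (if C \<in> class_of s ` dom grp then Some {N. \<exists>g. part_at w (C, g) = Some N} else None)" for C
    using w unfolding splitting_def by blast
  then show ?thesis
    by (auto simp: dom_def)
qed

lemma parts_eq:
  assumes "C \<in> dom (parts w)"
  shows "the (parts w C) = class_of (st w) ` {p \<in> dom grp. class_of s p = C}"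
proof -
  have "the (parts w C) = {N. \<exists>g. part_at w (C, g) = Some N}"
    using w assms unfolding dom_parts splitting_def by auto
  also have "\<dots> = class_of (st w) ` {p \<in> dom grp. class_of s p = C}"
  proof (intro equalityI subsetI)
    fix N
    assume "N \<in> {N. \<exists>g. part_at w (C, g) = Some N}"
    then obtain g where g: "part_at w (C, g) = Some N"
      by blast
    then have "(C, g) \<in> (\<lambda>p. (class_of s p, the (grp p))) ` dom grp"
      using w unfolding splitting_def by blast
    then show "N \<in> class_of (st w) ` {p \<in> dom grp. class_of s p = C}"
      using class_moved(1) g by (force simp: image_iff)
  next
    fix N
    assume "N \<in> class_of (st w) ` {p \<in> dom grp. class_of s p = C}"
    then show "N \<in> {N. \<exists>g. part_at w (C, g) = Some N}"
      using class_moved(1) by blast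
  qed
  finally show ?thesis .
qed

text \<open>The states that stay behind contribute the number \<open>C\<close> precisely when there
  are any, which is the case distinction in \<open>subclasses\<close>.\<close>

lemma subclasses_eq:
  assumes "C \<in> dom (parts w)"
  shows "subclasses (parts w) (st w) C = class_of (st w) ` members s C"
proof -
  have C: "C < next_class s"
    using assms class_less unfolding dom_parts dom_grp by auto
  have m: "members (st w) C = {x \<in> aug_states A. x \<notin> dom grp \<and> class_of s x = C}"
  proof -
    have "class_of (st w) x = C \<longleftrightarrow> x \<notin> dom grp \<and> class_of s x = C" for x
    proof (cases "x \<in> dom grp")
      case True
      then show ?thesis
        using class_moved(2)[OF True] C by simp
    next
      case False
      then show ?thesis
        using class_unmoved[OF False] by simp
    qed
    then show ?thesis
      unfolding split_members by simp
  qed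
  have "members s C = {p \<in> dom grp. class_of s p = C} \<union> members (st w) C"
    unfolding m valid_store_members[OF v] using dom_grp by blast
  moreover have "class_of (st w) ` members (st w) C = (if members (st w) C = {} then {} else {C})"
    unfolding split_members by auto
  ultimately show ?thesis
    unfolding subclasses_def parts_eq[OF assms] by (simp add: image_Un)
qed

lemma parts_new: "C \<in> dom (parts w) \<Longrightarrow> N \<in> the (parts w C) \<Longrightarrow> next_class s \<le> N \<and> N < next_class (st w)"
  using class_moved(2,3) by (auto simp: parts_eq)

lemma parts_old: "C \<in> dom (parts w) \<Longrightarrow> C < next_class s"
  using class_less unfolding dom_parts dom_grp by auto

lemma queue_less: "C \<in> queue s \<Longrightarrow> C < next_class s"
  using v unfolding valid_store_def by blast

lemma parts_disjoint:
  assumes "C \<in> dom (parts w)" "C' \<in> dom (parts w)" "C \<noteq> C'"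
  shows "the (parts w C) \<inter> the (parts w C') = {}"
proof -
  have "class_of s p = class_of s p'" if "p \<in> dom grp" "p' \<in> dom grp" "class_of (st w) p = class_of (st w) p'" for p p'
    using that split_class_eq[of p p'] dom_grp by blast
  then show ?thesis
    using assms(3) unfolding parts_eq[OF assms(1)] parts_eq[OF assms(2)] by blast
qed

text \<open>Neither the touched classes nor their new subclasses outnumber the moved states, so 13 +
  4 = 17 operations per moved state suffice.\<close>

lemma parts_cost: "(\<Sum>C\<in>dom (parts w). 13 + 4 * card (the (parts w C))) \<le> 17 * card (dom grp)"
proof -
  have fin_dom: "finite (dom (parts w))"
    unfolding dom_parts using fin_grp by simp
  have "(\<Sum>C\<in>dom (parts w). 13 + 4 * card (the (parts w C)))
      = 13 * card (dom (parts w)) + 4 * (\<Sum>C\<in>dom (parts w). card (the (parts w C)))"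
    by (simp add: sum.distrib sum_distrib_left)
  also have "(\<Sum>C\<in>dom (parts w). card (the (parts w C)))
      \<le> (\<Sum>C\<in>dom (parts w). card {p \<in> dom grp. class_of s p = C})"
    by (rule sum_mono) (use fin_grp in \<open>simp add: parts_eq card_image_le\<close>)
  also have "\<dots> = card (\<Union>C\<in>dom (parts w). {p \<in> dom grp. class_of s p = C})"
    by (rule card_UN_disjoint[symmetric]) (use fin_dom fin_grp in auto)
  also have "\<dots> \<le> card (dom grp)"
    by (rule card_mono) (use fin_grp in auto)
  also have "card (dom (parts w)) \<le> card (dom grp)"
    unfolding dom_parts using fin_grp by (rule card_image_le)
  finally show ?thesis
    by simp
qed

lemma split_by_requeue:
  assumes requeued: "\<And>C. C \<in> dom (parts w) \<Longrightarrow> requeued (parts w) (st w) C q"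
    and rest: "q - (\<Union>C\<in>dom (parts w). insert C (the (parts w C)))
      = queue (st w) - (\<Union>C\<in>dom (parts w). insert C (the (parts w C)))"
    and s0: "s = s0\<lparr>queue := queue s0 - {D}\<rparr>" and M: "M = members s D"
  shows "split_by A s0 D (st w\<lparr>queue := q\<rparr>)"
proof -
  let ?cl = "class_of (st w)"
  have queue_w: "queue (st w) = queue s" and le: "next_class s \<le> next_class (st w)" and preds_w: "preds (st w) = preds s"
    using w unfolding splitting_def by blast+
  have inner: "q \<inter> insert C (the (parts w C)) \<subseteq> ?cl ` members s C" if "C \<in> dom (parts w)" for C
    using requeued[OF that] unfolding requeued_def Let_def subclasses_eq[OF that] by (auto split: if_splits)
  have outer: "C \<in> q \<longleftrightarrow> C \<in> queue s" if "\<And>C'. C' \<in> dom (parts w) \<Longrightarrow> C \<notin> insert C' (the (parts w C'))" for C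
    using rest that unfolding queue_w by blast
  have old: "C \<in> q \<longleftrightarrow> C \<in> queue s" if "C < next_class s" "C \<notin> dom (parts w)" for C
  proof (rule outer)
    show "C \<notin> insert C' (the (parts w C'))" if "C' \<in> dom (parts w)" for C'
      using parts_new[OF that, of C] \<open>C < next_class s\<close> \<open>C \<notin> dom (parts w)\<close> that by auto
  qed
  have cl_less: "?cl x < next_class (st w)" if "x \<in> aug_states A" for x
    using class_moved(3)[of x] class_unmoved[of x] class_less[OF that] le by fastforce
  have unmoved: "?cl x = class_of s x" if "class_of s x \<notin> dom (parts w)" for x
    using that class_unmoved[of x] unfolding dom_parts by blast
  have members_sub: "members s C \<subseteq> aug_states A" for C
    unfolding valid_store_members[OF v] by blast
  have q_less: "q \<subseteq> {..<next_class (st w)}"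
  proof
    fix C
    assume "C \<in> q"
    show "C \<in> {..<next_class (st w)}"
    proof (cases "\<exists>C'\<in>dom (parts w). C \<in> insert C' (the (parts w C'))")
      case True
      then have "C \<in> ?cl ` aug_states A"
        using inner members_sub \<open>C \<in> q\<close> by blast
      then show ?thesis
        using cl_less by auto
    next
      case False
      then have "C < next_class s"
        using outer \<open>C \<in> q\<close> queue_less by blast
      then show ?thesis
        using le by simp
    qed
  qed
  show ?thesis
    unfolding split_by_def
  proof (intro conjI ballI allI impI)
    show "valid_store A (st w\<lparr>queue := q\<rparr>)"
      using v q_less cl_less split_members preds_w unfolding valid_store_def by simp
    show "preds (st w\<lparr>queue := q\<rparr>) x = preds s0 x" for x
      using preds_w s0 by simp
    show "class_of (st w\<lparr>queue := q\<rparr>) x = class_of (st w\<lparr>queue := q\<rparr>) y \<longleftrightarrow>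
        class_of s0 x = class_of s0 y \<and> signature A x (members s0 D) = signature A y (members s0 D)"
      if "x \<in> aug_states A" "y \<in> aug_states A" for x y
      using split_class_eq[OF that] unfolding M s0 by simp
    show "class_of (st w\<lparr>queue := q\<rparr>) x \<in> queue (st w\<lparr>queue := q\<rparr>)"
      if "x \<in> aug_states A" "class_of s0 x \<in> queue s0 - {D}" for x
    proof -
      have x: "class_of s x \<in> queue s"
        using that s0 by simp
      show ?thesis
      proof (cases "class_of s x \<in> dom (parts w)")
        case True
        then have "q \<inter> insert (class_of s x) (the (parts w (class_of s x))) = ?cl ` members s (class_of s x)"
          using requeued[OF True] x unfolding requeued_def Let_def subclasses_eq[OF True] queue_w by simp
        then show ?thesis
          using that(1) valid_store_members[OF v] by auto
      next
        case False
        then show ?thesis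
          using x old[OF class_less[OF that(1)] False] unmoved[OF False] by simp
      qed
    qed
    show "\<exists>L\<in>class_of (st w\<lparr>queue := q\<rparr>) ` members s0 C. L \<notin> queue (st w\<lparr>queue := q\<rparr>) \<and>
           (\<forall>x\<in>members s0 C. card (members (st w\<lparr>queue := q\<rparr>) (class_of (st w\<lparr>queue := q\<rparr>) x))
               \<le> card (members (st w\<lparr>queue := q\<rparr>) L) \<and>
              (class_of (st w\<lparr>queue := q\<rparr>) x = L \<or>
               class_of (st w\<lparr>queue := q\<rparr>) x \<in> queue (st w\<lparr>queue := q\<rparr>)))"
      if "C \<notin> queue s0 - {D} \<and> members s0 C \<noteq> {}" for C
    proof -
      have C: "C \<notin> queue s" "members s C \<noteq> {}" and m: "members s0 C = members s C"
        using that s0 by simp_all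
      have "\<exists>L\<in>?cl ` members s C. L \<notin> q \<and> (\<forall>x\<in>members s C.
          card (members (st w) (?cl x)) \<le> card (members (st w) L) \<and> (?cl x = L \<or> ?cl x \<in> q))"
      proof (cases "C \<in> dom (parts w)")
        case True
        obtain L where L: "L \<in> ?cl ` members s C"
          "\<forall>N\<in>?cl ` members s C. card (members (st w) N) \<le> card (members (st w) L)"
          "q \<inter> insert C (the (parts w C)) = ?cl ` members s C - {L}"
          using requeued[OF True] C unfolding requeued_def Let_def subclasses_eq[OF True] queue_w by auto
        have "?cl ` members s C \<subseteq> insert C (the (parts w C))"
          unfolding subclasses_eq[OF True, symmetric] subclasses_def by auto
        with L show ?thesis
          by (intro bexI[of _ L]) auto
      next
        case False
        \<comment> \<open>No state of \<open>C\<close> moves: \<open>C\<close> keeps its number and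
          is its own largest subclass.\<close>
        obtain x where "x \<in> members s C"
          using C by blast
        moreover have "?cl x = C" if "x \<in> members s C" for x
          using that unmoved[of x] False valid_store_members[OF v] by auto
        moreover have "C < next_class s"
          using C(2) class_less valid_store_members[OF v] by auto
        ultimately show ?thesis
          using C(1) old[of C] False by (intro bexI[of _ C]) auto
      qed
      then show ?thesis
        by (simp add: m)
    qed
    show "{C \<in> queue (st w\<lparr>queue := q\<rparr>). members (st w\<lparr>queue := q\<rparr>) C = {}}
        \<subseteq> {C \<in> queue s0. members s0 C = {}} - {D}"
    proof
      fix C
      assume "C \<in> {C \<in> queue (st w\<lparr>queue := q\<rparr>). members (st w\<lparr>queue := q\<rparr>) C = {}}"
      then have C: "C \<in> q" "members (st w) C = {}"
        by simp_all
      have none: "x \<in> aug_states A \<Longrightarrow> ?cl x \<noteq> C" for x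
        using C(2) unfolding split_members by blast
      \<comment> \<open>Queued numbers inside a block belong to subclasses that have states, so an
        empty one must lie outside all blocks.\<close>
      have no: "C \<notin> insert C' (the (parts w C'))" if "C' \<in> dom (parts w)" for C'
        using inner[OF that] C(1) none members_sub by blast
      then have "C \<in> queue s" "C \<notin> dom (parts w)"
        using outer[of C] C(1) by blast+
      moreover have "members s C = {}"
        using none unmoved \<open>C \<notin> dom (parts w)\<close> unfolding valid_store_members[OF v] by auto
      ultimately show "C \<in> {C \<in> queue s0. members s0 C = {}} - {D}"
        using s0 by simp
    qed
  qed
qed

lemma wp_requeue_parts:
  assumes "s = s0\<lparr>queue := queue s0 - {D}\<rparr>" "M = members s D"
  shows "wp (foreach (dom (parts w)) (requeue (parts w)) (st w))
    (\<lambda>s' t. split_by A s0 D s' \<and> t \<le> 1 + 17 * card (dom grp))"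
proof (rule wp_mono[OF wp_requeue_all], goal_cases)
  case 1
  then show ?case
    unfolding dom_parts using fin_grp by simp
next
  case (2 C Ns)
  then have C: "C \<in> dom (parts w)" "Ns = the (parts w C)"
    by auto
  have "queue (st w) = queue s"
    using w unfolding splitting_def by blast
  moreover have "N \<notin> queue s \<and> N \<notin> dom (parts w)" if "N \<in> Ns" for N
    using parts_new[OF C(1)] parts_old[of N] queue_less[of N] that unfolding C(2) by (meson not_le)
  ultimately have "Ns \<inter> queue (st w) = {}" "Ns \<inter> dom (parts w) = {}"
    by auto
  then show ?case
    using C(1) fin_grp unfolding C(2) parts_eq[OF C(1)] by (auto simp: dom_parts)
next
  case (3 C C' Ns Ns')
  then show ?case
    using parts_disjoint[of C C'] by (simp add: domI)
next
  case (4 s' t)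
  then obtain q where "s' = st w\<lparr>queue := q\<rparr>" "\<forall>C\<in>dom (parts w). requeued (parts w) (st w) C q"
    "q - (\<Union>C\<in>dom (parts w). insert C (the (parts w C)))
      = queue (st w) - (\<Union>C\<in>dom (parts w). insert C (the (parts w C)))"
    by blast
  then have "split_by A s0 D s'"
    using split_by_requeue[of q, OF _ _ assms] by blast
  moreover have "t \<le> 1 + 17 * card (dom grp)"
    using 4 parts_cost by linarith
  ultimately show ?case
    by blast
qed

end

text \<open>With \<open>W\<close> for the sum, the four phases cost at most
  \<open>1 + 6 * W\<close>, \<open>2 + 12 * W\<close>, \<open>2 + 14 * W\<close> and
  \<open>1 + 17 * W\<close>; the extraction adds two operations.\<close>

lemma wp_split_round:
  fixes A :: "('q, 'a::finite, 'k::semiring_0) automaton"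
  assumes v: "valid_store A s" and fin: "finite (states A)" and ne: "queue s \<noteq> {}"
  shows "wp (split_round s) (\<lambda>s' t. \<exists>D\<in>queue s. split_by A s D s' \<and>
    t \<le> 8 + 49 * (\<Sum>x\<in>members s D. 1 + card (preds s x)))"
  unfolding split_round_def
proof (rule wp_bind, unfold wp_pick wp_bind_op1, intro conjI ballI ne)
  fix D
  assume D: "D \<in> queue s"
  let ?s = "s\<lparr>queue := queue s - {D}\<rparr>" and ?W = "\<Sum>x\<in>members s D. 1 + card (preds s x)"
  have v': "valid_store A ?s"
    using v unfolding valid_store_def by auto
  show "wp (compute_signatures D ?s \<bind> (\<lambda>tab. weak_sort tab \<bind> (\<lambda>grp. split_classes grp ?s \<bind>
         (\<lambda>w. foreach (dom (parts w)) (requeue (parts w)) (st w)))))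
     (\<lambda>s' t. \<exists>D\<in>queue s. split_by A s D s' \<and>
       1 + Suc t \<le> 8 + 49 * (\<Sum>x\<in>members s D. 1 + card (preds s x)))"
  proof (rule wp_bind, rule wp_mono[OF wp_compute_signatures[OF v' fin]], elim conjE)
    fix tab :: "('q, 'a, 'k) sigtab" and t1
    assume t1: "t1 \<le> 1 + 6 * (\<Sum>x\<in>members ?s D. 1 + card (preds ?s x))"
      and sig: "\<forall>a. \<forall>p\<in>aug_states A. entry tab a p = signature A p (members ?s D) a"
      and keys: "keys tab \<subseteq> UNIV \<times> aug_states A" "card (keys tab) \<le> (\<Sum>x\<in>members ?s D. card (preds ?s x))"
      and dom: "dom tab = fst ` keys tab"
    have fk: "finite (keys tab)"
      by (rule finite_subset[OF keys(1)]) (use fin in simp)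
    have ck: "card (keys tab) \<le> ?W"
      by (rule order.trans[OF keys(2)]) (simp add: sum_mono)
    show "wp (weak_sort tab \<bind> (\<lambda>grp. split_classes grp ?s \<bind>
         (\<lambda>w. foreach (dom (parts w)) (requeue (parts w)) (st w))))
       (\<lambda>s' u. \<exists>D\<in>queue s. split_by A s D s' \<and>
         1 + Suc (t1 + u) \<le> 8 + 49 * (\<Sum>x\<in>members s D. 1 + card (preds s x)))"
    proof (rule wp_bind, rule wp_mono[OF wp_weak_sort[OF fk dom]], elim conjE)
      fix grp :: "'q astate \<rightharpoonup> nat" and t2
      assume t2: "t2 \<le> 2 + 12 * card (keys tab)"
        and dg: "dom grp = {p. \<exists>a. entry tab a p \<noteq> 0}"
        and grp: "\<forall>p\<in>dom grp. \<forall>q\<in>dom grp. grp p = grp q \<longleftrightarrow> (\<forall>a. entry tab a p = entry tab a q)"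
      \<comment> \<open>A nonzero signature requires an entry in the table; hence the cost per moved
        state can be charged to entries.\<close>
      have sub: "dom grp \<subseteq> snd ` keys tab"
        unfolding dg by (force simp: entry_def keys_def image_iff dom_def split: option.splits)
      then have X: "dom grp \<subseteq> aug_states A"
        using keys(1) by fastforce
      have cg: "card (dom grp) \<le> card (keys tab)"
        using card_mono[OF finite_imageI[OF fk] sub] card_image_le[OF fk, of snd] by linarith
      have dg': "dom grp = {p \<in> aug_states A. signature A p (members ?s D) \<noteq> (\<lambda>_. 0)}"
      proof -
        have "dom grp = {p \<in> aug_states A. \<exists>a. entry tab a p \<noteq> 0}"
          using X unfolding dg by blast
        then show ?thesis
          using sig by (auto simp: fun_eq_iff)
      qed
      have grp': "grp p = grp q \<longleftrightarrow> signature A p (members ?s D) = signature A q (members ?s D)"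
        if "p \<in> dom grp" "q \<in> dom grp" for p q
        using grp sig X that unfolding fun_eq_iff by (metis subsetD)
      show "wp (split_classes grp ?s \<bind> (\<lambda>w. foreach (dom (parts w)) (requeue (parts w)) (st w)))
        (\<lambda>s' u. \<exists>D\<in>queue s. split_by A s D s' \<and>
           1 + Suc (t1 + (t2 + u)) \<le> 8 + 49 * (\<Sum>x\<in>members s D. 1 + card (preds s x)))"
      proof (rule wp_bind, rule wp_mono[OF wp_split_classes[OF v' X fin]], elim conjE)
        fix w :: "('q, 'a, 'k) split_state" and t3
        assume w: "splitting A ?s grp (dom grp) (dom grp) w" and t3: "t3 \<le> 2 + 14 * card (dom grp)"
        show "wp (foreach (dom (parts w)) (requeue (parts w)) (st w))
          (\<lambda>s' u. \<exists>D\<in>queue s. split_by A s D s' \<and>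
           1 + Suc (t1 + (t2 + (t3 + u))) \<le> 8 + 49 * (\<Sum>x\<in>members s D. 1 + card (preds s x)))"
        proof (rule wp_mono[OF wp_requeue_parts[OF v' fin dg' grp' w refl refl]])
          fix s' t4
          assume "split_by A s D s' \<and> t4 \<le> 1 + 17 * card (dom grp)"
          moreover from this have "1 + Suc (t1 + (t2 + (t3 + t4))) \<le> 8 + 49 * ?W"
            using t1 t2 t3 ck cg by simp
          ultimately show "\<exists>D\<in>queue s. split_by A s D s' \<and>
             1 + Suc (t1 + (t2 + (t3 + t4))) \<le> 8 + 49 * (\<Sum>x\<in>members s D. 1 + card (preds s x))"
            using D by blast
        qed
      qed
    qed
  qed
qed

section \<open>Amortised running time\<close>

text \<open>
  Every state pays for itself and its incoming transitions each time its class is extracted.  It can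
  afford this because a class enters the queue only by a split that at least halves its size.  The
  last summand is needed only for the automaton without states, whose class 1 is empty.
\<close>

lemma
  assumes "split_by A s D s'"
  shows split_by_valid: "valid_store A s'"
    and split_by_preds: "x \<in> aug_states A \<Longrightarrow> preds s' x = preds s x"
    and split_by_class: "x \<in> aug_states A \<Longrightarrow> y \<in> aug_states A \<Longrightarrow> class_of s' x = class_of s' y \<longleftrightarrow>
      class_of s x = class_of s y \<and> signature A x (members s D) = signature A y (members s D)"
    and split_by_queued: "x \<in> aug_states A \<Longrightarrow> class_of s x \<in> queue s - {D} \<Longrightarrow> class_of s' x \<in> queue s'"
    and split_by_unqueued: "C \<notin> queue s - {D} \<Longrightarrow> members s C \<noteq> {} \<Longrightarrow>
      \<exists>L\<in>class_of s' ` members s C. L \<notin> queue s' \<and>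
        (\<forall>x\<in>members s C. card (members s' (class_of s' x)) \<le> card (members s' L) \<and>
           (class_of s' x = L \<or> class_of s' x \<in> queue s'))"
    and split_by_empty: "{C \<in> queue s'. members s' C = {}} \<subseteq> {C \<in> queue s. members s C = {}} - {D}"
proof -
  note 1 = assms[unfolded split_by_def]
  note 2 = conjunct2[OF 1]
  note 3 = conjunct2[OF 2]
  note 4 = conjunct2[OF 3]
  note 5 = conjunct2[OF 4]
  show "valid_store A s'"
    by (rule conjunct1[OF 1])
  show "x \<in> aug_states A \<Longrightarrow> preds s' x = preds s x"
    by (rule bspec[OF conjunct1[OF 2]])
  show "x \<in> aug_states A \<Longrightarrow> y \<in> aug_states A \<Longrightarrow> class_of s' x = class_of s' y \<longleftrightarrow>
      class_of s x = class_of s y \<and> signature A x (members s D) = signature A y (members s D)"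
    using conjunct1[OF 3] by blast
  show "x \<in> aug_states A \<Longrightarrow> class_of s x \<in> queue s - {D} \<Longrightarrow> class_of s' x \<in> queue s'"
    using conjunct1[OF 4] by blast
  show "C \<notin> queue s - {D} \<Longrightarrow> members s C \<noteq> {} \<Longrightarrow>
      \<exists>L\<in>class_of s' ` members s C. L \<notin> queue s' \<and>
        (\<forall>x\<in>members s C. card (members s' (class_of s' x)) \<le> card (members s' L) \<and>
           (class_of s' x = L \<or> class_of s' x \<in> queue s'))"
    using conjunct1[OF 5] by simp
  show "{C \<in> queue s'. members s' C = {}} \<subseteq> {C \<in> queue s. members s C = {}} - {D}"
    by (rule conjunct2[OF 5])
qed

text \<open>A bound for the number of extractions that can still reach \<open>x\<close>: a queued
  class holds one in advance, and every later entry into the queue is paid for by halving the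
  class.\<close>

definition level :: "('q, 'a, 'k) store \<Rightarrow> 'q astate \<Rightarrow> nat" where
  "level s x = floor_log (card (members s (class_of s x))) + (if class_of s x \<in> queue s then 1 else 0)"

definition potential :: "('q, 'a, 'k) automaton \<Rightarrow> ('q, 'a, 'k) store \<Rightarrow> nat" where
  "potential A s =
     (\<Sum>x\<in>aug_states A. (1 + card (preds s x)) * level s x) + card {C \<in> queue s. members s C = {}}"

lemma floor_log_halve: "0 < a \<Longrightarrow> 2 * a \<le> b \<Longrightarrow> floor_log a + 1 \<le> floor_log b"
  using floor_log_le_iff[of "2 * a" b] by simp

text \<open>A state of a class that is still queued stays queued, in a class that is not larger. Any
  other state either lands in the omitted class \<open>L\<close>, without the bonus for the queue,
  or in a class disjoint from \<open>L\<close> and not larger than \<open>L\<close>, hence at most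
  half of the old class: the logarithm drops by one and pays for the new bonus. If the old class is
  \<open>D\<close>, its own bonus pays for the extraction.\<close>

lemma split_by_level:
  fixes A :: "('q, 'a, 'k::semiring_0) automaton"
  assumes v: "valid_store A s" and fin: "finite (states A)" and D: "D \<in> queue s"
    and split: "split_by A s D s'" and x: "x \<in> aug_states A"
  shows "level s' x + (if class_of s x = D then 1 else 0) \<le> level s x"
proof -
  let ?C = "class_of s x" and ?N = "class_of s' x"
  have v': "valid_store A s'"
    using split by (rule split_by_valid)
  have refine: "class_of s' y = class_of s' z \<Longrightarrow> class_of s y = class_of s z"
    if "y \<in> aug_states A" "z \<in> aug_states A" for y z
    using split_by_class[OF split] that by blast
  have sub: "members s' (class_of s' y) \<subseteq> members s (class_of s y)" if "y \<in> aug_states A" for y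
    using refine that unfolding valid_store_members[OF v] valid_store_members[OF v'] by blast
  have finm: "finite (members s C)" "finite (members s' C)" for C
    using fin unfolding valid_store_members[OF v] valid_store_members[OF v'] by simp_all
  have le: "floor_log (card (members s' ?N)) \<le> floor_log (card (members s ?C))"
    using sub[OF x] finm by (intro floor_log_le_iff card_mono)
  have xC: "x \<in> members s ?C" "x \<in> members s' ?N"
    using x unfolding valid_store_members[OF v] valid_store_members[OF v'] by simp_all
  show ?thesis
  proof (cases "?C \<in> queue s - {D}")
    case True
    then have "?N \<in> queue s'"
      using split_by_queued[OF split x] by blast
    then show ?thesis
      using True le by (simp add: level_def)
  next
    case False
    then have "\<exists>L\<in>class_of s' ` members s ?C. L \<notin> queue s' \<and>
           (\<forall>x\<in>members s ?C. card (members s' (class_of s' x)) \<le> card (members s' L) \<and>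
              (class_of s' x = L \<or> class_of s' x \<in> queue s'))"
      using split_by_unqueued[OF split] xC(1) by blast
    then obtain L where L: "L \<in> class_of s' ` members s ?C" "L \<notin> queue s'"
      "card (members s' ?N) \<le> card (members s' L)"
      using xC(1) by blast
    have queued: "?C \<in> queue s \<longleftrightarrow> ?C = D"
      using False D by blast
    show ?thesis
    proof (cases "?N = L")
      case True
      then show ?thesis
        using L(2) le queued by (simp add: level_def)
    next
      case False
      obtain y where y: "y \<in> aug_states A" "class_of s y = ?C" "L = class_of s' y"
        using L(1) unfolding valid_store_members[OF v] by blast
      have "members s' ?N \<inter> members s' L = {}"
        using False unfolding valid_store_members[OF v'] by auto
      then have "card (members s' ?N) + card (members s' L) = card (members s' ?N \<union> members s' L)"
        using finm by (simp add: card_Un_disjoint)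
      also have "\<dots> \<le> card (members s ?C)"
        using sub[OF x] sub[OF y(1)] y(2,3) finm by (intro card_mono) auto
      finally have "2 * card (members s' ?N) \<le> card (members s ?C)"
        using L(3) by simp
      moreover have "0 < card (members s' ?N)"
        using xC(2) finm by (auto simp: card_gt_0_iff)
      ultimately show ?thesis
        using floor_log_halve[of "card (members s' ?N)" "card (members s ?C)"] queued by (simp add: level_def)
    qed
  qed
qed

lemma split_by_potential:
  fixes A :: "('q, 'a, 'k::semiring_0) automaton"
  assumes v: "valid_store A s" and fin: "finite (states A)" and D: "D \<in> queue s"
    and split: "split_by A s D s'"
  shows "potential A s' + (\<Sum>x\<in>members s D. 1 + card (preds s x)) + (if members s D = {} then 1 else 0)
    \<le> potential A s"
proof -
  let ?w = "\<lambda>x. 1 + card (preds s x)"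
  have preds: "preds s' x = preds s x" if "x \<in> aug_states A" for x
    using split that by (rule split_by_preds)
  have f1: "(\<Sum>x\<in>members s D. ?w x) = (\<Sum>x\<in>aug_states A. if class_of s x = D then ?w x else 0)"
    unfolding valid_store_members[OF v] by (rule sum.inter_filter) (use fin in simp)
  have f2: "(\<Sum>x\<in>aug_states A. (1 + card (preds s' x)) * level s' x) = (\<Sum>x\<in>aug_states A. ?w x * level s' x)"
    by (rule sum.cong) (simp_all only: preds)
  have "(\<Sum>x\<in>aug_states A. (1 + card (preds s' x)) * level s' x) + (\<Sum>x\<in>members s D. ?w x)
      = (\<Sum>x\<in>aug_states A. ?w x * level s' x + (if class_of s x = D then ?w x else 0))"
    unfolding f1 f2 by (rule sum.distrib[symmetric])
  also have "\<dots> = (\<Sum>x\<in>aug_states A. ?w x * (level s' x + (if class_of s x = D then 1 else 0)))"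
    by (rule sum.cong[OF refl], simp only: distrib_left split: if_split) simp
  also have "\<dots> \<le> (\<Sum>x\<in>aug_states A. ?w x * level s x)"
    by (intro sum_mono mult_le_mono2 split_by_level[OF v fin D split])
  finally have main: "(\<Sum>x\<in>aug_states A. (1 + card (preds s' x)) * level s' x) + (\<Sum>x\<in>members s D. ?w x)
      \<le> (\<Sum>x\<in>aug_states A. ?w x * level s x)" .
  let ?E = "\<lambda>s. {C \<in> queue s. members s C = {}}"
  have "queue s \<subseteq> {..<next_class s}"
    using v unfolding valid_store_def by blast
  then have "?E s \<subseteq> {..<next_class s}"
    by blast
  then have finE: "finite (?E s)"
    by (rule finite_subset) simp
  have E: "?E s' \<subseteq> ?E s - {D}"
    using split by (rule split_by_empty)
  \<comment> \<open>Extracting an empty class removes it from the queue, and no other empty class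
    enters.\<close>
  have "card (?E s') + (if members s D = {} then 1 else 0) \<le> card (?E s)"
  proof (cases "members s D = {}")
    case True
    then have "D \<in> ?E s"
      using D by simp
    then have "?E s' \<subset> ?E s"
      using E by auto
    then show ?thesis
      using True psubset_card_mono[OF finE, of "?E s'"] by simp
  next
    case False
    have "?E s' \<subseteq> ?E s"
      using E by blast
    then show ?thesis
      using False card_mono[OF finE, of "?E s'"] by simp
  qed
  with main show ?thesis
    unfolding potential_def by linarith
qed

lemma wp_split_round_amortised:
  fixes A :: "('q, 'a::finite, 'k::semiring_0) automaton"
  assumes v: "valid_store A s" and fin: "finite (states A)" and ne: "queue s \<noteq> {}"
  shows "wp (split_round s) (\<lambda>s' t. (\<exists>D\<in>queue s. split_by A s D s') \<and>
    1 + t + 58 * potential A s' \<le> 58 * potential A s)"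
proof (rule wp_mono[OF wp_split_round[OF v fin ne]], elim bexE conjE)
  fix s' t D
  assume D: "D \<in> queue s" and split: "split_by A s D s'"
    and t: "t \<le> 8 + 49 * (\<Sum>x\<in>members s D. 1 + card (preds s x))"
  let ?W = "\<Sum>x\<in>members s D. 1 + card (preds s x)"
  have "finite (members s D)"
    using fin unfolding valid_store_members[OF v] by simp
  then have "members s D \<noteq> {} \<Longrightarrow> 1 \<le> ?W"
    by (simp only: sum.distrib) (simp add: card_gt_0_iff Suc_le_eq)
  \<comment> \<open>This drop of the potential is positive even for an empty \<open>D\<close>, so it
    absorbs the constant part as well: 8 operations of the round and the loop test, 8 + 1 + 49 =
    58.\<close>
  then have "1 \<le> ?W + (if members s D = {} then 1 else 0)"
    by auto
  then have "1 + t + 58 * potential A s' \<le> 58 * potential A s"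
    using t split_by_potential[OF v fin D split] by linarith
  with D split show "(\<exists>D\<in>queue s. split_by A s D s') \<and> 1 + t + 58 * potential A s' \<le> 58 * potential A s"
    by blast
qed

section \<open>Initialisation\<close>

definition initial_store :: "('q, 'a, 'k::zero) automaton \<Rightarrow> ('q, 'a, 'k) store \<Rightarrow> bool" where
  "initial_store A s \<longleftrightarrow> valid_store A s \<and> queue s = {1, 2} \<and>
     class_of s Ini = 0 \<and> (\<forall>q\<in>states A. class_of s (St q) = 1) \<and> class_of s Fin = 2"

lemma finite_transitions: "finite (states A) \<Longrightarrow> finite (transitions (A :: ('q, 'a::finite, 'k::zero) automaton))"
  by (rule finite_subset[of _ "states A \<times> UNIV \<times> states A"]) (auto simp: transitions_def)

lemma aug_weight_nonzeroE:
  assumes "aug_weight A p a x \<noteq> 0"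
  obtains q where "p = Ini" "a = None" "x = St q"
    | p' b q where "p = St p'" "a = Some b" "x = St q"
    | q where "p = St q" "a = None" "x = Fin"
  using assms by (cases "(A, p, a, x)" rule: aug_weight.cases) auto

text \<open>Two operations per transition; seven per state, namely one of the traversal, four that
  are always executed and at most two insertions of transitions. The initial record and the ends of
  the two traversals give 3.\<close>

lemma wp_init_store:
  fixes A :: "('q, 'a::finite, 'k::semiring_0) automaton"
  assumes fin: "finite (states A)"
  shows "wp (init_store A) (\<lambda>s t. initial_store A s \<and>
    t \<le> 3 + 2 * card (transitions A) + 7 * card (states A))"
proof -
  let ?start = "\<lparr> preds = (\<lambda>_. {}), class_of = (\<lambda>_. 0)(Ini := 0, Fin := 2),
    members = (\<lambda>_. {})(0 := {Ini}, 2 := {Fin}), next_class = 3, queue = {1, 2} \<rparr> :: ('q, 'a, 'k) store"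
  \<comment> \<open>Closed forms of the incoming transitions inserted so far: \<open>?inner\<close>
    for those of the given automaton, \<open>?outer\<close> for those that involve
    \<open>Ini\<close> or \<open>Fin\<close>.\<close>
  let ?inner = "\<lambda>R y. {(St p, Some a, weight A p a q) | p a q. (p, a, q) \<in> R \<and> y = St q}"
  let ?outer = "\<lambda>R y. {(Ini, None :: 'a option, initial_weight A q) | q. q \<in> R \<and> y = St q \<and> initial_weight A q \<noteq> 0} \<union>
    {(St q, None, final_weight A q) | q. q \<in> R \<and> y = Fin \<and> final_weight A q \<noteq> 0}"
  let ?I1 = "\<lambda>R s. s = ?start\<lparr>preds := ?inner R\<rparr>"
  let ?I2 = "\<lambda>R s. next_class s = 3 \<and> queue s = {1, 2} \<and>
    (\<forall>x. class_of s x = (if x \<in> St ` R then 1 else class_of ?start x)) \<and>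
    (\<forall>C. members s C = (if C = 1 then St ` R else members ?start C)) \<and>
    (\<forall>x. preds s x = ?inner (transitions A) x \<union> ?outer R x)"
  show ?thesis
    unfolding init_store_def wp_bind_op1
  proof (rule wp_bind, rule wp_foreach[where c = "\<lambda>_. 1" and I = ?I1])
    fix R x s
    assume "?I1 R s"
    then show "wp ((case x of (p, a, q) \<Rightarrow> add_pred (St p) (Some a) (weight A p a q) (St q)) s)
      (\<lambda>s' u. ?I1 (insert x R) s' \<and> u \<le> 1)"
      by (auto simp: add_pred_def fun_eq_iff split: prod.split)
  next
    fix s :: "('q, 'a, 'k) store" and t1 :: nat
    assume s: "?I1 (transitions A) s" and t1: "t1 \<le> 1 + (\<Sum>x\<in>transitions A. 1 + 1)"
    show "wp (foreach (states A) (\<lambda>q s. op1 (s\<lparr>class_of := (class_of s)(St q := 1)\<rparr>) \<bind>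
       (\<lambda>s. op1 (s\<lparr>members := (members s)(1 := insert (St q) (members s 1))\<rparr>) \<bind>
       (\<lambda>s. op1 (initial_weight A q = 0) \<bind>
       (\<lambda>z. (if z then ret s else add_pred Ini None (initial_weight A q) (St q) s) \<bind>
       (\<lambda>s. op1 (final_weight A q = 0) \<bind>
       (\<lambda>z. if z then ret s else add_pred (St q) None (final_weight A q) Fin s)))))) s)
     (\<lambda>s u. initial_store A s \<and> Suc (t1 + u) \<le> 3 + 2 * card (transitions A) + 7 * card (states A))"
    proof (rule wp_foreach[where c = "\<lambda>_. 6" and I = ?I2])
      show "?I2 {} s"
        using s by auto
    next
      fix R q and s :: "('q, 'a, 'k) store"
      assume I: "?I2 R s"
      let ?P = "\<lambda>x. (if x = St q \<and> initial_weight A q \<noteq> 0 then {(Ini, None :: 'a option, initial_weight A q)} else {})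
          \<union> (if x = Fin \<and> final_weight A q \<noteq> 0 then {(St q, None, final_weight A q)} else {})"
      let ?s = "s\<lparr>preds := \<lambda>x. preds s x \<union> ?P x, class_of := (class_of s)(St q := 1),
          members := (members s)(1 := insert (St q) (members s 1))\<rparr>"
      have I': "?I2 (insert q R) ?s"
      proof (intro conjI allI)
        show "preds ?s x = ?inner (transitions A) x \<union> ?outer (insert q R) x" for x
        proof -
          have "?outer (insert q R) x = ?outer R x \<union> ?P x"
            by auto
          moreover have "\<forall>x. preds s x = ?inner (transitions A) x \<union> ?outer R x"
            using I by (elim conjE)
          moreover have "preds ?s x = preds s x \<union> ?P x"
            by simp
          ultimately show ?thesis
            by (simp only: Un_assoc)
        qed
        show "class_of ?s x = (if x \<in> St ` insert q R then 1 else class_of ?start x)" for x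
        proof -
          have "\<forall>x. class_of s x = (if x \<in> St ` R then 1 else class_of ?start x)"
            using I by (elim conjE)
          then show ?thesis
            by simp
        qed
        show "members ?s C = (if C = 1 then St ` insert q R else members ?start C)" for C
        proof -
          have "\<forall>C. members s C = (if C = 1 then St ` R else members ?start C)"
            using I by (elim conjE)
          then show ?thesis
            by simp
        qed
      qed (use I in simp_all)
      have "wp (op1 (s\<lparr>class_of := (class_of s)(St q := 1)\<rparr>) \<bind>
       (\<lambda>s. op1 (s\<lparr>members := (members s)(1 := insert (St q) (members s 1))\<rparr>) \<bind>
       (\<lambda>s. op1 (initial_weight A q = 0) \<bind>
       (\<lambda>z. (if z then ret s else add_pred Ini None (initial_weight A q) (St q) s) \<bind>
       (\<lambda>s. op1 (final_weight A q = 0) \<bind>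
       (\<lambda>z. if z then ret s else add_pred (St q) None (final_weight A q) Fin s))))))
       (\<lambda>s' u. s' = ?s \<and> u \<le> 6)"
        by (cases "initial_weight A q = 0"; cases "final_weight A q = 0") (simp_all add: add_pred_def fun_eq_iff)
      then show "wp (op1 (s\<lparr>class_of := (class_of s)(St q := 1)\<rparr>) \<bind>
       (\<lambda>s. op1 (s\<lparr>members := (members s)(1 := insert (St q) (members s 1))\<rparr>) \<bind>
       (\<lambda>s. op1 (initial_weight A q = 0) \<bind>
       (\<lambda>z. (if z then ret s else add_pred Ini None (initial_weight A q) (St q) s) \<bind>
       (\<lambda>s. op1 (final_weight A q = 0) \<bind>
       (\<lambda>z. if z then ret s else add_pred (St q) None (final_weight A q) Fin s))))))
       (\<lambda>s' u. ?I2 (insert q R) s' \<and> u \<le> 6)"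
        by (rule wp_mono) (use I' in \<open>simp only: simp_thms\<close>)
    next
      fix s :: "('q, 'a, 'k) store" and t2 :: nat
      assume s: "?I2 (states A) s" and t2: "t2 \<le> 1 + (\<Sum>x\<in>states A. 1 + 6)"
      have fields: "next_class s = 3" "queue s = {1, 2}"
        using s by simp_all
      have cl: "\<forall>x. class_of s x = (if x \<in> St ` states A then 1 else class_of ?start x)"
        using s by (elim conjE)
      have mem: "\<forall>C. members s C = (if C = 1 then St ` states A else members ?start C)"
        using s by (elim conjE)
      have ps: "\<forall>x. preds s x = ?inner (transitions A) x \<union> ?outer (states A) x"
        using s by (elim conjE)
      have preds: "preds s x = {(p, a, k). p \<in> aug_states A \<and> k = aug_weight A p a x \<and> k \<noteq> 0}"
        if "x \<in> aug_states A" for x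
      proof (intro equalityI subsetI)
        fix y
        assume "y \<in> preds s x"
        then have "y \<in> ?inner (transitions A) x \<union> ?outer (states A) x"
          by (simp only: ps)
        then show "y \<in> {(p, a, k). p \<in> aug_states A \<and> k = aug_weight A p a x \<and> k \<noteq> 0}"
          by (auto simp: transitions_def aug_states_def)
      next
        fix y
        assume "y \<in> {(p, a, k). p \<in> aug_states A \<and> k = aug_weight A p a x \<and> k \<noteq> 0}"
        then obtain p a where y: "y = (p, a, aug_weight A p a x)" "p \<in> aug_states A" "aug_weight A p a x \<noteq> 0"
          by blast
        then have "y \<in> ?inner (transitions A) x \<union> ?outer (states A) x"
          using that by (cases rule: aug_weight_nonzeroE[OF y(3)]) (auto simp: transitions_def aug_states_def)
        then show "y \<in> preds s x"
          by (simp only: ps)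
      qed
      have "valid_store A s"
        unfolding valid_store_def
      proof (intro conjI ballI allI)
        show "members s C = {x \<in> aug_states A. class_of s x = C}" for C
          using cl mem by (auto simp: aug_states_def)
        show "class_of s x < next_class s" for x
          using cl fields by simp
      qed (use preds fields in auto)
      then have "initial_store A s"
        using cl fields by (auto simp: initial_store_def)
      then show "initial_store A s \<and> Suc (t1 + t2) \<le> 3 + 2 * card (transitions A) + 7 * card (states A)"
        using t1 t2 by simp
    qed (rule fin)
  qed (use finite_transitions[OF fin] in \<open>auto simp: fun_eq_iff\<close>)
qed

text \<open>For n states and m transitions, the augmented automaton has n + 2 states and at most m +
  2n transitions, which together give the first factor. The second is the maximal level, as no
  initial class has more than n states.\<close>

lemma initial_potential:
  fixes A :: "('q, 'a::finite, 'k::semiring_0) automaton"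
  assumes fin: "finite (states A)" and s: "initial_store A s" and n: "2 \<le> card (states A)"
  shows "potential A s \<le> (3 * card (states A) + card (transitions A) + 2) * (floor_log (card (states A)) + 1)"
proof -
  let ?n = "card (states A)" and ?X = "aug_states A"
  have v: "valid_store A s"
    using s unfolding initial_store_def by blast
  have m: "members s 0 = {Ini}" "members s 1 = St ` states A" "members s 2 = {Fin}"
    using s unfolding valid_store_members[OF v] by (auto simp: initial_store_def aug_states_def)
  have cl: "class_of s x \<in> {0, 1, 2}" if "x \<in> ?X" for x
    using s that unfolding initial_store_def aug_states_def by auto
  have "St ` states A \<noteq> {}"
    using n by auto
  \<comment> \<open>Class 1 is nonempty, so the correction term of the potential vanishes.\<close>
  then have E: "{C \<in> queue s. members s C = {}} = {}"
    using s m unfolding initial_store_def by auto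
  have card: "card (members s (class_of s x)) \<le> ?n" if "x \<in> ?X" for x
    using cl[OF that] m n by (auto simp: card_image inj_on_def)
  have level: "level s x \<le> floor_log ?n + 1" if "x \<in> ?X" for x
    using floor_log_le_iff[OF card[OF that]] by (simp add: level_def)
  have "(\<Sum>x\<in>?X. 1 + card (preds s x)) = card ?X + card (SIGMA x:?X. preds s x)"
    using fin finite_preds[OF v fin] by (simp only: sum.distrib) simp
  also have "card ?X = ?n + 2"
    using fin by (simp add: aug_states_def card_image inj_on_def image_iff)
  also have "card (SIGMA x:?X. preds s x) \<le> card (transitions A) + 2 * ?n"
  proof -
    let ?T = "(\<lambda>(p, a, q). (St q, St p, Some a, weight A p a q)) ` transitions A"
    let ?I = "(\<lambda>q. (St q, Ini :: 'q astate, None :: 'a option, initial_weight A q)) ` states A"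
    let ?F = "(\<lambda>q. (Fin :: 'q astate, St q, None :: 'a option, final_weight A q)) ` states A"
    have "(SIGMA x:?X. preds s x) \<subseteq> ?T \<union> (?I \<union> ?F)"
    proof
      fix y
      assume "y \<in> (SIGMA x:?X. preds s x)"
      then obtain x p a where y: "y = (x, p, a, aug_weight A p a x)" "x \<in> ?X" "p \<in> ?X" "aug_weight A p a x \<noteq> 0"
        using valid_store_preds[OF v] by auto
      then show "y \<in> ?T \<union> (?I \<union> ?F)"
      proof (cases rule: aug_weight_nonzeroE[OF y(4)])
        case (1 q)
        then show ?thesis
          using y by (auto simp: aug_states_def)
      next
        case (2 p' b q)
        then have "(p', b, q) \<in> transitions A"
          using y by (auto simp: transitions_def aug_states_def)
        moreover have "y = (case (p', b, q) of (p, a, q) \<Rightarrow> (St q, St p, Some a, weight A p a q))"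
          using 2 y(1) by simp
        ultimately have "y \<in> ?T"
          by (rule rev_image_eqI)
        then show ?thesis
          by (rule UnI1)
      next
        case (3 q)
        then show ?thesis
          using y by (auto simp: aug_states_def)
      qed
    qed
    then have "card (SIGMA x:?X. preds s x) \<le> card (?T \<union> (?I \<union> ?F))"
      using fin finite_transitions[OF fin] by (intro card_mono) simp_all
    also have "\<dots> \<le> card ?T + (card ?I + card ?F)"
      using card_Un_le[of ?T "?I \<union> ?F"] card_Un_le[of ?I ?F] by linarith
    also have "\<dots> \<le> card (transitions A) + (?n + ?n)"
      using fin finite_transitions[OF fin] by (intro add_mono card_image_le)
    finally show ?thesis
      by simp
  qed
  finally have W: "(\<Sum>x\<in>?X. 1 + card (preds s x)) \<le> 3 * ?n + card (transitions A) + 2"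
    by simp
  have "potential A s \<le> (\<Sum>x\<in>?X. (1 + card (preds s x)) * (floor_log ?n + 1))"
    unfolding potential_def E card.empty add_0_right by (intro sum_mono mult_le_mono2 level)
  also have "\<dots> = (\<Sum>x\<in>?X. 1 + card (preds s x)) * (floor_log ?n + 1)"
    by (simp only: sum_distrib_right)
  also have "\<dots> \<le> (3 * ?n + card (transitions A) + 2) * (floor_log ?n + 1)"
    using W by (rule mult_le_mono1)
  finally show ?thesis .
qed

section \<open>Morphisms and stable partitions\<close>

lemma sum_amalgamation:
  fixes f :: "'q \<Rightarrow> 'k::{semiring_0, monoid_mult}"
  assumes "finite Q"
  shows "(\<Sum>q\<in>Q. f q * amalgamation \<phi> q r) = (\<Sum>q\<in>{q \<in> Q. \<phi> q = r}. f q)"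
proof -
  have "(\<Sum>q\<in>Q. f q * amalgamation \<phi> q r) = (\<Sum>q\<in>Q. if \<phi> q = r then f q else 0)"
    by (rule sum.cong) (simp_all add: amalgamation_def)
  then show ?thesis
    using assms by (simp add: sum.inter_filter)
qed

lemma amalgamation_sum:
  fixes f :: "'r \<Rightarrow> 'k::{semiring_0, monoid_mult}"
  assumes "finite R" "\<phi> p \<in> R"
  shows "(\<Sum>r\<in>R. amalgamation \<phi> p r * f r) = f (\<phi> p)"
proof -
  have "(\<Sum>r\<in>R. amalgamation \<phi> p r * f r) = (\<Sum>r\<in>R. if \<phi> p = r then f r else 0)"
    by (rule sum.cong) (simp_all add: amalgamation_def)
  then show ?thesis
    using assms by simp
qed

text \<open>Multiplication by the amalgamation matrix from the right sums over fibres; from the left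
  it selects the row of the image.\<close>

lemma is_morphism_iff:
  fixes A :: "('q, 'a, 'k::{semiring_0, monoid_mult}) automaton"
  assumes fin: "finite (states A)"
  shows "is_morphism \<phi> A B \<longleftrightarrow>
     \<phi> ` states A = states B \<and>
     (\<forall>r\<in>states B. (\<Sum>p\<in>{p \<in> states A. \<phi> p = r}. initial_weight A p) = initial_weight B r) \<and>
     (\<forall>a. \<forall>p\<in>states A. \<forall>r\<in>states B.
        (\<Sum>q\<in>{q \<in> states A. \<phi> q = r}. weight A p a q) = weight B (\<phi> p) a r) \<and>
     (\<forall>p\<in>states A. final_weight A p = final_weight B (\<phi> p))"
proof (cases "\<phi> ` states A = states B")
  case True
  then have B: "finite (states B)" "p \<in> states A \<Longrightarrow> \<phi> p \<in> states B" for p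
    using fin finite_imageI[OF fin, of \<phi>] by auto
  show ?thesis
    unfolding is_morphism_def sum_amalgamation[OF fin] using B by (simp add: amalgamation_sum)
qed (simp add: is_morphism_def)

lemma signature_St_Some:
  assumes "finite M"
  shows "signature A (St p) M (Some a) = (\<Sum>q\<in>{q. St q \<in> M}. weight A p a q)"
proof -
  have "signature A (St p) M (Some a) = (\<Sum>x\<in>St ` {q. St q \<in> M}. aug_weight A (St p) (Some a) x)"
    unfolding signature_def
  proof (rule sum.mono_neutral_right[OF assms])
    show "\<forall>x\<in>M - St ` {q. St q \<in> M}. aug_weight A (St p) (Some a) x = 0"
    proof
      fix x
      assume "x \<in> M - St ` {q. St q \<in> M}"
      then show "aug_weight A (St p) (Some a) x = 0"
        by (cases x) auto
    qed
  qed auto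
  also have "\<dots> = (\<Sum>q\<in>{q. St q \<in> M}. weight A p a q)"
    by (subst sum.reindex) (auto simp: inj_on_def)
  finally show ?thesis .
qed

lemma signature_St_None:
  assumes "finite M"
  shows "signature A (St p) M None = (if Fin \<in> M then final_weight A p else 0)"
proof -
  have "aug_weight A (St p) None x = (if x = Fin then final_weight A p else 0)" for x
    by (cases x) auto
  then show ?thesis
    using assms by (simp add: signature_def)
qed

text \<open>The assumption concerns sets of original states. Removing \<open>Ini\<close> and
  \<open>Fin\<close> does not change the values at original letters. At the additional letter, if
  \<open>Fin\<close> is in \<open>D - C\<close> it is also in \<open>D\<close>, whose equal
  signatures already give equal final weights.\<close>

lemma simplifiable_signatures_diff:
  fixes A :: "('q, 'a, 'k::semiring_0) automaton"
  assumes simplifiable: "simplifiable_signatures A" and fin: "finite (states A)"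
    and sub: "C \<subseteq> D" "D \<subseteq> aug_states A" and pq: "p \<in> states A" "q \<in> states A"
    and D: "signature A (St p) D = signature A (St q) D"
    and C: "signature A (St p) C = signature A (St q) C"
  shows "signature A (St p) (D - C) = signature A (St q) (D - C)"
proof -
  let ?r = "\<lambda>M. St ` {q. St q \<in> M}"
  have finM: "finite M" if "M \<subseteq> D" for M
    by (rule finite_subset[of _ "aug_states A"]) (use that sub fin in auto)
  have fin_r: "finite (?r M)" if "M \<subseteq> D" for M
    by (rule finite_subset[OF _ finM[OF that]]) auto
  have r: "signature A (St p) (?r M) = signature A (St q) (?r M) \<longleftrightarrow>
      (\<forall>a. signature A (St p) M (Some a) = signature A (St q) M (Some a))" if "M \<subseteq> D" for M
  proof -
    have "signature A (St p) (?r M) (Some a) = signature A (St p) M (Some a)" for p a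
      using signature_St_Some[OF finM[OF that], of A p a] signature_St_Some[OF fin_r[OF that], of A p a]
      by (simp add: image_iff)
    moreover have "signature A (St p) (?r M) None = 0" for p
      using signature_St_None[OF fin_r[OF that], of A p] by (simp add: image_iff)
    ultimately show ?thesis
      unfolding fun_eq_iff split_option_all by simp
  qed
  have "?r D \<subseteq> St ` states A"
    using sub(2) unfolding aug_states_def by auto
  moreover have "?r C \<subseteq> ?r D"
    using sub(1) by auto
  moreover have "signature A (St p) (?r D) = signature A (St q) (?r D)"
    using D by (subst r) auto
  moreover have "signature A (St p) (?r C) = signature A (St q) (?r C)"
    using C sub(1) by (subst r) auto
  ultimately have "signature A (St p) (?r D - ?r C) = signature A (St q) (?r D - ?r C)"
    using simplifiable[unfolded simplifiable_signatures_def, rule_format, of "?r C" "?r D" "St p" "St q"] pq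
    by blast
  moreover have "?r D - ?r C = ?r (D - C)"
    by auto
  ultimately have some: "\<forall>a. signature A (St p) (D - C) (Some a) = signature A (St q) (D - C) (Some a)"
    using r[of "D - C"] by simp
  have none: "signature A (St p) (D - C) None = signature A (St q) (D - C) None"
  proof (cases "Fin \<in> D - C")
    case True
    have "signature A (St p) D None = signature A (St q) D None"
      using D by simp
    then show ?thesis
      using True unfolding signature_St_None[OF finM[OF order.refl]] signature_St_None[OF finM[OF Diff_subset]]
      by simp
  next
    case False
    then show ?thesis
      unfolding signature_St_None[OF finM[OF Diff_subset]] by auto
  qed
  show ?thesis
  proof
    fix a
    show "signature A (St p) (D - C) a = signature A (St q) (D - C) a"
      using some none by (cases a) auto
  qed
qed

text \<open>A saturated set is, on the original states, a union of fibres of the morphism, and the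
  sum over a fibre depends on the source state only through its image.\<close>

lemma congruence_signature:
  fixes A :: "('q, 'a, 'k::{semiring_0, monoid_mult}) automaton"
  assumes fin: "finite (states A)" and r: "congruence A r" "(p, q) \<in> r" and M: "finite M" "{q. St q \<in> M} \<subseteq> states A"
    and sat: "\<And>x y. (x, y) \<in> r \<Longrightarrow> St x \<in> M \<Longrightarrow> St y \<in> M"
  shows "signature A (St p) M = signature A (St q) M"
proof -
  obtain \<phi> :: "'q \<Rightarrow> 'q set" and B where mor: "is_morphism \<phi> A B" and ker: "r = kernel_on (states A) \<phi>"
    using r(1) unfolding congruence_def by blast
  have pq: "p \<in> states A" "q \<in> states A" "\<phi> p = \<phi> q"
    using r(2) unfolding ker kernel_on_def by auto
  let ?Q = "{q. St q \<in> M}"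
  have finQ: "finite ?Q"
    using M(2) fin by (rule finite_subset)
  have "\<phi> ` states A = states B \<and> (\<forall>a. \<forall>p\<in>states A. \<forall>r\<in>states B.
        (\<Sum>q\<in>{q \<in> states A. \<phi> q = r}. weight A p a q) = weight B (\<phi> p) a r) \<and>
     (\<forall>p\<in>states A. final_weight A p = final_weight B (\<phi> p))"
    using mor unfolding is_morphism_iff[OF fin] by (elim conjE) (intro conjI)
  then have fin_pq: "final_weight A p = final_weight A q"
    and w: "\<And>a r. r \<in> \<phi> ` states A \<Longrightarrow> (\<Sum>q'\<in>{q' \<in> states A. \<phi> q' = r}. weight A p a q')
      = (\<Sum>q'\<in>{q' \<in> states A. \<phi> q' = r}. weight A q a q')"
    using pq by simp_all
  have block: "{q' \<in> ?Q. \<phi> q' = r} = {q' \<in> states A. \<phi> q' = r}" if "r \<in> \<phi> ` ?Q" for r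
  proof -
    from that obtain q0 where q0: "St q0 \<in> M" "r = \<phi> q0"
      by blast
    have "St q' \<in> M" if "q' \<in> states A" "\<phi> q' = r" for q'
      using sat[of q0 q'] q0 M(2) that unfolding ker kernel_on_def by auto
    then show ?thesis
      using M(2) by blast
  qed
  have split: "(\<Sum>q'\<in>?Q. weight A p a q') = (\<Sum>r\<in>\<phi> ` ?Q. \<Sum>q'\<in>{q' \<in> states A. \<phi> q' = r}. weight A p a q')" for p a
  proof -
    have "(\<Sum>q'\<in>?Q. weight A p a q') = (\<Sum>r\<in>\<phi> ` ?Q. \<Sum>q'\<in>{q' \<in> ?Q. \<phi> q' = r}. weight A p a q')"
      by (rule sum.group[OF finQ finite_imageI[OF finQ] order.refl, symmetric])
    also have "\<dots> = (\<Sum>r\<in>\<phi> ` ?Q. \<Sum>q'\<in>{q' \<in> states A. \<phi> q' = r}. weight A p a q')"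
      by (rule sum.cong[OF refl]) (simp only: block)
    finally show ?thesis .
  qed
  have "(\<Sum>q'\<in>?Q. weight A p a q') = (\<Sum>q'\<in>?Q. weight A q a q')" for a
    unfolding split by (rule sum.cong[OF refl], rule w) (use M(2) in blast)
  then have eq: "signature A (St p) M (Some a) = signature A (St q) M (Some a)" for a
    by (simp add: signature_St_Some[OF M(1)])
  show ?thesis
  proof
    fix a
    show "signature A (St p) M a = signature A (St q) M a"
      using eq fin_pq by (cases a) (simp_all add: signature_St_None[OF M(1)])
  qed
qed

section \<open>Correctness\<close>

definition stable :: "('q, 'a, 'k::semiring_0) automaton \<Rightarrow> ('q, 'a, 'k) store \<Rightarrow> 'q astate set \<Rightarrow> bool" where
  "stable A s M \<longleftrightarrow> (\<forall>p\<in>states A. \<forall>q\<in>states A. class_of s (St p) = class_of s (St q) \<longrightarrow>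
     signature A (St p) M = signature A (St q) M)"

definition coarse :: "('q, 'a, 'k::{semiring_0, monoid_mult}) automaton \<Rightarrow> ('q, 'a, 'k) store \<Rightarrow> bool" where
  "coarse A s \<longleftrightarrow> (\<forall>r p q. congruence A r \<longrightarrow> (p, q) \<in> r \<longrightarrow> class_of s (St p) = class_of s (St q))"

text \<open>
  A class outside the queue need not be stable itself, but it becomes so when the classes in \<open>W\<close> have
  been extracted and their union is subtracted: this is where simplifiable signatures are used.
\<close>

definition queue_suffices :: "('q, 'a, 'k::semiring_0) automaton \<Rightarrow> ('q, 'a, 'k) store \<Rightarrow> bool" where
  "queue_suffices A s \<longleftrightarrow> (\<forall>C. C \<notin> queue s \<longrightarrow> members s C \<noteq> {} \<longrightarrow>
     (\<exists>W\<subseteq>queue s. stable A s (\<Union>(members s ` insert C W))))"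

definition invariant :: "('q, 'a, 'k::{semiring_0, monoid_mult}) automaton \<Rightarrow> ('q, 'a, 'k) store \<Rightarrow> bool" where
  "invariant A s \<longleftrightarrow> valid_store A s \<and> (\<forall>p\<in>states A. class_of s (St p) \<noteq> class_of s Fin) \<and>
     coarse A s \<and> queue_suffices A s"

lemma congruence_states: "congruence A r \<Longrightarrow> (p, q) \<in> r \<Longrightarrow> p \<in> states A \<and> q \<in> states A"
  unfolding congruence_def kernel_on_def by auto

lemma St_in_aug_states [simp]: "St p \<in> aug_states A \<longleftrightarrow> p \<in> states A"
  by (auto simp: aug_states_def)

lemma Fin_in_aug_states [simp]: "Fin \<in> aug_states A"
  by (simp add: aug_states_def)

text \<open>Since the partition is coarser than \<open>r\<close>, the class \<open>D\<close> is
  saturated for \<open>r\<close>; states related by \<open>r\<close> thus have the same signature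
  and are not separated.\<close>

lemma coarse_split_by:
  fixes A :: "('q, 'a, 'k::{semiring_0, monoid_mult}) automaton"
  assumes v: "valid_store A s" and fin: "finite (states A)" and coarse: "coarse A s"
    and split: "split_by A s D s'"
  shows "coarse A s'"
  unfolding coarse_def
proof (intro allI impI)
  fix r p q
  assume r: "congruence A r" "(p, q) \<in> r"
  have eq: "class_of s (St x) = class_of s (St y)" if "(x, y) \<in> r" for x y
    using coarse r(1) that unfolding coarse_def by blast
  have "signature A (St p) (members s D) = signature A (St q) (members s D)"
  proof (rule congruence_signature[OF fin r])
    show "finite (members s D)" "{q. St q \<in> members s D} \<subseteq> states A"
      using fin by (auto simp: valid_store_members[OF v])
    show "St y \<in> members s D" if "(x, y) \<in> r" "St x \<in> members s D" for x y
      using eq[OF that(1)] that(2) congruence_states[OF r(1) that(1)]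
      by (simp add: valid_store_members[OF v])
  qed
  then show "class_of s' (St p) = class_of s' (St q)"
    using split_by_class[OF split, of "St p" "St q"] congruence_states[OF r] eq[OF r(2)] by simp
qed

lemma stable_split_by:
  assumes "stable A s M" "split_by A s D s'"
  shows "stable A s' M"
  unfolding stable_def
proof (intro ballI impI)
  fix p q
  assume pq: "p \<in> states A" "q \<in> states A" "class_of s' (St p) = class_of s' (St q)"
  then have "class_of s (St p) = class_of s (St q)"
    using split_by_class[OF assms(2), of "St p" "St q"] by simp
  then show "signature A (St p) M = signature A (St q) M"
    using assms(1) pq unfolding stable_def by blast
qed

lemma stable_extracted:
  assumes "split_by A s D s'"
  shows "stable A s' (members s D)"
  unfolding stable_def
proof (intro ballI impI)
  fix p q
  assume "p \<in> states A" "q \<in> states A" "class_of s' (St p) = class_of s' (St q)"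
  then show "signature A (St p) (members s D) = signature A (St q) (members s D)"
    using split_by_class[OF assms, of "St p" "St q"] by simp
qed

lemma stable_diff:
  fixes A :: "('q, 'a, 'k::semiring_0) automaton"
  assumes "simplifiable_signatures A" "finite (states A)" "C \<subseteq> D" "D \<subseteq> aug_states A" "stable A s D" "stable A s C"
  shows "stable A s (D - C)"
  unfolding stable_def
proof (intro ballI impI)
  fix p q
  assume "p \<in> states A" "q \<in> states A" "class_of s (St p) = class_of s (St q)"
  moreover from this have "signature A (St p) D = signature A (St q) D" "signature A (St p) C = signature A (St q) C"
    using assms(5,6) unfolding stable_def by blast+
  ultimately show "signature A (St p) (D - C) = signature A (St q) (D - C)"
    using simplifiable_signatures_diff[OF assms(1-4)] by blast
qed

text \<open>The family for \<open>C'\<close> is derived from that of its old class: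
  \<open>D\<close>, stable after the round, is subtracted if it occurs, and the remaining union is
  rewritten in terms of new classes, all of which except \<open>C'\<close> are queued.\<close>

lemma queue_suffices_split_by:
  fixes A :: "('q, 'a, 'k::semiring_0) automaton"
  assumes v: "valid_store A s" and fin: "finite (states A)" and simplifiable: "simplifiable_signatures A"
    and queue: "queue_suffices A s" and split: "split_by A s D s'"
  shows "queue_suffices A s'"
  unfolding queue_suffices_def
proof (intro allI impI)
  fix C'
  assume C': "C' \<notin> queue s'" "members s' C' \<noteq> {}"
  have v': "valid_store A s'"
    using split by (rule split_by_valid)
  obtain x where x: "x \<in> aug_states A" "C' = class_of s' x"
    using C'(2) unfolding valid_store_members[OF v'] by blast
  let ?C = "class_of s x"
  have C: "?C \<notin> queue s - {D}" "members s ?C \<noteq> {}"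
    using split_by_queued[OF split x(1)] C'(1) x unfolding valid_store_members[OF v] by blast+
  have "\<exists>W\<subseteq>queue s - {D}. stable A s' (\<Union>(members s ` insert ?C W))"
  proof (cases "?C = D")
    case True
    \<comment> \<open>The extracted class is stable by itself, so the empty family works.\<close>
    then show ?thesis
      using stable_extracted[OF split] by (intro exI[of _ "{}"]) simp
  next
    case False
    then have "?C \<notin> queue s"
      using C(1) by blast
    then obtain W where W: "W \<subseteq> queue s" "stable A s (\<Union>(members s ` insert ?C W))"
      using queue C(2) unfolding queue_suffices_def by blast
    have W': "stable A s' (\<Union>(members s ` insert ?C W))"
      using W(2) split by (rule stable_split_by)
    show ?thesis
    proof (cases "D \<in> W")
      case True
      have disj: "members s C1 \<inter> members s C2 = {}" if "C1 \<noteq> C2" for C1 C2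
        using that unfolding valid_store_members[OF v] by auto
      have "\<Union>(members s ` insert ?C W) - members s D = \<Union>(members s ` insert ?C (W - {D}))"
        using False disj by auto
      moreover have "stable A s' (\<Union>(members s ` insert ?C W) - members s D)"
        using W' stable_extracted[OF split] True
        by (intro stable_diff[OF simplifiable fin]) (auto simp: valid_store_members[OF v])
      ultimately show ?thesis
        using W(1) by (intro exI[of _ "W - {D}"]) auto
    next
      case False
      then show ?thesis
        using W(1) W' by blast
    qed
  qed
  then obtain W where W: "W \<subseteq> queue s - {D}" "stable A s' (\<Union>(members s ` insert ?C W))"
    by blast
  let ?U = "\<Union>(members s ` insert ?C W)"
  let ?W = "class_of s' ` ?U - {C'}"
  obtain L where L: "\<forall>y\<in>members s ?C. class_of s' y = L \<or> class_of s' y \<in> queue s'"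
    using split_by_unqueued[OF split C] by blast
  have xC: "x \<in> members s ?C"
    using x(1) unfolding valid_store_members[OF v] by blast
  \<comment> \<open>Only one subclass of an unqueued class stays outside the queue, so
    \<open>C'\<close> must be that one and all its siblings are queued.\<close>
  have "L = C'"
    using bspec[OF L xC] C'(1) x(2) by simp
  have "?W \<subseteq> queue s'"
  proof
    fix N
    assume "N \<in> ?W"
    then obtain y where y: "y \<in> ?U" "N = class_of s' y" "N \<noteq> C'"
      by blast
    show "N \<in> queue s'"
    proof (cases "y \<in> members s ?C")
      case True
      then show ?thesis
        using L \<open>L = C'\<close> y by blast
    next
      case False
      then obtain E where "E \<in> W" "y \<in> members s E"
        using y(1) by blast
      then have "y \<in> aug_states A" "class_of s y \<in> queue s - {D}"
        using W(1) unfolding valid_store_members[OF v] by auto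
      then show ?thesis
        unfolding y(2) by (rule split_by_queued[OF split])
    qed
  qed
  \<comment> \<open>\<open>?U\<close> consists of complete old classes, and the new partition
    refines the old one.\<close>
  moreover have "\<Union>(members s' ` insert C' ?W) = ?U"
  proof -
    have "insert C' ?W = class_of s' ` ?U"
      using xC x(2) by auto
    moreover have "\<Union>(members s' ` class_of s' ` ?U) = ?U"
    proof (intro equalityI subsetI)
      fix z
      assume "z \<in> \<Union>(members s' ` class_of s' ` ?U)"
      then obtain y E where y: "E \<in> insert ?C W" "y \<in> members s E" "z \<in> members s' (class_of s' y)"
        by blast
      then have "y \<in> aug_states A" "z \<in> aug_states A" "class_of s' z = class_of s' y"
        unfolding valid_store_members[OF v] valid_store_members[OF v'] by auto
      then have "class_of s z = class_of s y"
        using split_by_class[OF split, of z y] by simp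
      then have "z \<in> members s E"
        using y(2) \<open>z \<in> aug_states A\<close> unfolding valid_store_members[OF v] by auto
      then show "z \<in> ?U"
        using y(1) by blast
    next
      fix z
      assume z: "z \<in> ?U"
      then have "z \<in> aug_states A"
        unfolding valid_store_members[OF v] by blast
      then have "z \<in> members s' (class_of s' z)"
        unfolding valid_store_members[OF v'] by simp
      then show "z \<in> \<Union>(members s' ` class_of s' ` ?U)"
        using z by blast
    qed
    ultimately show ?thesis
      by simp
  qed
  ultimately show "\<exists>W\<subseteq>queue s'. stable A s' (\<Union>(members s' ` insert C' W))"
    using W(2) by (intro exI[of _ ?W]) simp
qed

lemma invariant_split_by:
  fixes A :: "('q, 'a, 'k::{semiring_0, monoid_mult}) automaton"
  assumes inv: "invariant A s" and fin: "finite (states A)" and simplifiable: "simplifiable_signatures A"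
    and split: "split_by A s D s'"
  shows "invariant A s'"
proof -
  have v: "valid_store A s" and "coarse A s" "queue_suffices A s"
    and Fin: "\<forall>p\<in>states A. class_of s (St p) \<noteq> class_of s Fin"
    using inv unfolding invariant_def by - (elim conjE, assumption)+
  then have "coarse A s'" "queue_suffices A s'"
    using coarse_split_by[OF v fin _ split] queue_suffices_split_by[OF v fin simplifiable _ split] by blast+
  moreover have "\<forall>p\<in>states A. class_of s' (St p) \<noteq> class_of s' Fin"
    using Fin split_by_class[OF split, of "St _" Fin] by simp
  ultimately show ?thesis
    using split_by_valid[OF split] unfolding invariant_def by simp
qed

text \<open>The only nonempty class outside the initial queue is that of \<open>Ini\<close>, which
  no transition enters.\<close>

lemma invariant_initial:
  fixes A :: "('q, 'a, 'k::{semiring_0, monoid_mult}) automaton"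
  assumes "initial_store A s"
  shows "invariant A s"
proof -
  have v: "valid_store A s" and queue: "queue s = {1, 2}" and "class_of s Ini = 0"
    and St: "\<forall>q\<in>states A. class_of s (St q) = 1" and Fin: "class_of s Fin = 2"
    using assms unfolding initial_store_def by blast+
  have "coarse A s"
    unfolding coarse_def using St congruence_states by metis
  moreover have "queue_suffices A s"
    unfolding queue_suffices_def
  proof (intro allI impI)
    fix C
    assume C: "C \<notin> queue s" "members s C \<noteq> {}"
    then have "members s C \<subseteq> {Ini}"
      using St Fin queue unfolding valid_store_members[OF v] aug_states_def by auto
    moreover have "aug_weight A x a Ini = 0" for x a
      by (cases "(A, x, a, Ini :: 'q astate)" rule: aug_weight.cases) auto
    ultimately have "signature A x (members s C) = (\<lambda>_. 0)" for x
      unfolding signature_def fun_eq_iff by (auto intro!: sum.neutral)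
    then show "\<exists>W\<subseteq>queue s. stable A s (\<Union>(members s ` insert C W))"
      by (intro exI[of _ "{}"]) (simp add: stable_def)
  qed
  ultimately show ?thesis
    using v St Fin unfolding invariant_def by simp
qed

text \<open>With an empty queue the completing family is empty, so every class is stable. Stability
  makes the quotient independent of the representatives, and \<open>coarse\<close> makes its kernel
  the coarsest congruence.\<close>

lemma minimal_quotient_of_invariant:
  fixes A :: "('q, 'a, 'k::{semiring_0, monoid_mult}) automaton"
  assumes inv: "invariant A s" and fin: "finite (states A)" and empty: "queue s = {}"
  shows "is_minimal_quotient A (quotient_by A (output_partition s))"
proof -
  have v: "valid_store A s" and coarse: "coarse A s" and queue: "queue_suffices A s"
    and Fin: "\<forall>p\<in>states A. class_of s (St p) \<noteq> class_of s Fin"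
    using inv unfolding invariant_def by - (elim conjE, assumption)+
  have finm: "finite (members s C)" for C
    using fin by (simp add: valid_store_members[OF v])
  have sig: "signature A (St p) (members s C) = signature A (St q) (members s C)"
    if "p \<in> states A" "q \<in> states A" "class_of s (St p) = class_of s (St q)" "members s C \<noteq> {}" for p q C
  proof -
    have "stable A s (members s C)"
      using queue that(4) empty unfolding queue_suffices_def by auto
    then show ?thesis
      using that unfolding stable_def by blast
  qed
  define r where "r = {(p, q). p \<in> states A \<and> q \<in> states A \<and> class_of s (St p) = class_of s (St q)}"
  let ?\<phi> = "\<lambda>p. r `` {p}" and ?P = "output_partition s"
  let ?B = "quotient_by A ?P"
  have img: "?\<phi> p = {q. St q \<in> members s (class_of s (St p))}" if "p \<in> states A" for p
    using that by (auto simp: r_def valid_store_members[OF v])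
  have eq_iff: "?\<phi> p = ?\<phi> q \<longleftrightarrow> class_of s (St p) = class_of s (St q)" if "p \<in> states A" "q \<in> states A" for p q
    using that by (auto simp: r_def)
  have P: "?P = ?\<phi> ` states A"
  proof (intro equalityI subsetI)
    fix X
    assume "X \<in> ?P"
    then obtain C p where X: "X = {q. St q \<in> members s C}" "p \<in> X"
      unfolding output_partition_def by blast
    then have "p \<in> states A" "C = class_of s (St p)"
      by (auto simp: valid_store_members[OF v])
    then show "X \<in> ?\<phi> ` states A"
      using img X(1) by blast
  next
    fix X
    assume "X \<in> ?\<phi> ` states A"
    then obtain p where p: "p \<in> states A" "X = ?\<phi> p"
      by blast
    then have "p \<in> X"
      by (simp add: r_def)
    moreover have "class_of s (St p) < next_class s"
      using v p(1) unfolding valid_store_def by simp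
    ultimately show "X \<in> ?P"
      using img[OF p(1)] p(2) unfolding output_partition_def by blast
  qed
  have fibre: "{q \<in> states A. ?\<phi> q = ?\<phi> p} = ?\<phi> p" if "p \<in> states A" for p
    using that eq_iff[of _ p] by (auto simp: r_def)
  have some: "(SOME p'. p' \<in> ?\<phi> p) \<in> states A" "class_of s (St (SOME p'. p' \<in> ?\<phi> p)) = class_of s (St p)"
    if "p \<in> states A" for p
  proof -
    have "p \<in> ?\<phi> p"
      using that by (simp add: r_def)
    then have "(SOME p'. p' \<in> ?\<phi> p) \<in> ?\<phi> p"
      by (rule someI)
    moreover have "z \<in> ?\<phi> p \<Longrightarrow> z \<in> states A \<and> class_of s (St z) = class_of s (St p)" for z
      by (simp add: r_def)
    ultimately show "(SOME p'. p' \<in> ?\<phi> p) \<in> states A" "class_of s (St (SOME p'. p' \<in> ?\<phi> p)) = class_of s (St p)"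
      by blast+
  qed
  have weight_eq: "(\<Sum>q\<in>?\<phi> q0. weight A p a q) = (\<Sum>q\<in>?\<phi> q0. weight A p' a q)"
    if "p \<in> states A" "p' \<in> states A" "q0 \<in> states A" "class_of s (St p) = class_of s (St p')" for p p' q0 a
  proof -
    have "St q0 \<in> members s (class_of s (St q0))"
      using that(3) by (simp add: valid_store_members[OF v])
    then have "members s (class_of s (St q0)) \<noteq> {}"
      by blast
    note eq = sig[OF that(1,2,4) this]
    show ?thesis
      unfolding img[OF that(3)] signature_St_Some[OF finm, symmetric] eq ..
  qed
  \<comment> \<open>At the additional letter only \<open>Fin\<close> contributes, so stability of
    the class of \<open>Fin\<close> is equality of final weights.\<close>
  have final_eq: "final_weight A p = final_weight A p'"
    if "p \<in> states A" "p' \<in> states A" "class_of s (St p) = class_of s (St p')" for p p'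
  proof -
    have "Fin \<in> members s (class_of s Fin)"
      by (simp add: valid_store_members[OF v])
    then have "members s (class_of s Fin) \<noteq> {}" and fin_mem: "Fin \<in> members s (class_of s Fin)"
      by blast+
    then have "signature A (St p) (members s (class_of s Fin)) None = signature A (St p') (members s (class_of s Fin)) None"
      using sig[OF that] by simp
    then show ?thesis
      unfolding signature_St_None[OF finm] using fin_mem by simp
  qed
  have mor: "is_morphism ?\<phi> A ?B"
    unfolding is_morphism_iff[OF fin]
  proof (intro conjI ballI allI)
    show "?\<phi> ` states A = states ?B"
      by (simp add: quotient_by_def P)
    show "(\<Sum>p\<in>{p \<in> states A. ?\<phi> p = X}. initial_weight A p) = initial_weight ?B X" if "X \<in> states ?B" for X
    proof -
      from that obtain p where p: "p \<in> states A" "X = ?\<phi> p"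
        by (auto simp: quotient_by_def P)
      show ?thesis
        unfolding p(2) fibre[OF p(1)] by (simp add: quotient_by_def)
    qed
    show "(\<Sum>q\<in>{q \<in> states A. ?\<phi> q = X}. weight A p a q) = weight ?B (?\<phi> p) a X"
      if "p \<in> states A" "X \<in> states ?B" for p a X
    proof -
      from that(2) obtain q0 where q0: "q0 \<in> states A" "X = ?\<phi> q0"
        by (auto simp: quotient_by_def P)
      show ?thesis
        unfolding q0(2) fibre[OF q0(1)]
        using weight_eq[OF that(1) some(1)[OF that(1)] q0(1) some(2)[OF that(1), symmetric]]
        by (simp add: quotient_by_def)
    qed
    show "final_weight A p = final_weight ?B (?\<phi> p)" if "p \<in> states A" for p
      using final_eq[OF that some(1)[OF that] some(2)[OF that, symmetric]] by (simp add: quotient_by_def)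
  qed
  have "kernel_on (states A) ?\<phi> = r"
    unfolding kernel_on_def r_def[symmetric] using eq_iff by (simp add: r_def cong: conj_cong)
  then have "congruence A r"
    using mor unfolding congruence_def by blast
  moreover have "t \<subseteq> r" if t: "congruence A t" for t
  proof (rule subrelI)
    fix p q
    assume pq: "(p, q) \<in> t"
    then have "class_of s (St p) = class_of s (St q)"
      using coarse t unfolding coarse_def by simp
    then show "(p, q) \<in> r"
      using congruence_states[OF t pq] by (simp add: r_def)
  qed
  ultimately have "coarsest_congruence A r"
    unfolding coarsest_congruence_def by blast
  moreover have "states ?B = states A // r"
    by (auto simp: quotient_by_def P quotient_def)
  ultimately show ?thesis
    using mor unfolding is_minimal_quotient_def by blast
qed

section \<open>Correctness and running time of the whole program\<close>

lemma fpcs_correct: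
  fixes A :: "('q, 'a::finite, 'k::{semiring_0, monoid_mult}) automaton"
  assumes fin: "finite (states A)" and simplifiable: "simplifiable_signatures A"
  shows "fpcs_halts A"
    and "(P, t) \<in> outcomes (fpcs A) \<Longrightarrow> is_minimal_quotient A (quotient_by A P)"
    and "(P, t) \<in> outcomes (fpcs A) \<Longrightarrow> 2 \<le> card (states A) \<Longrightarrow>
      t \<le> 4 + 2 * card (transitions A) + 7 * card (states A)
         + 58 * ((3 * card (states A) + card (transitions A) + 2) * (floor_log (card (states A)) + 1))"
proof -
  have round: "wp (split_round s) (\<lambda>s' t. invariant A s' \<and> 1 + t + 58 * potential A s' \<le> 58 * potential A s)"
    if "invariant A s" "queue s \<noteq> {}" for s
  proof -
    have "valid_store A s"
      using that(1) unfolding invariant_def by (elim conjE)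
    from wp_split_round_amortised[OF this fin that(2)] show ?thesis
    proof (rule wp_mono, elim conjE bexE, intro conjI)
      fix s' D
      assume "split_by A s D s'"
      then show "invariant A s'"
        by (rule invariant_split_by[OF that(1) fin simplifiable])
    qed
  qed
  have init: "initial_store A s \<and> t \<le> 3 + 2 * card (transitions A) + 7 * card (states A)"
    if "(s, t) \<in> outcomes (init_store A)" for s t
    using wpD[OF wp_init_store[OF fin] that] .
  show "fpcs_halts A"
    unfolding fpcs_halts_def
  proof (intro conjI ballI)
    show "outcomes (init_store A) \<noteq> {}"
      using wp_init_store[OF fin] unfolding wp_def by (rule conjunct1)
  next
    fix y
    assume y: "y \<in> outcomes (init_store A)"
    obtain s t where st: "y = (s, t)"
      by (cases y)
    have "invariant A s"
      using init[of s t] y st invariant_initial by blast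
    \<comment> \<open>The loop test alone costs 1, so the amortised bound forces the potential to
      decrease strictly.\<close>
    then have "loop_halts (\<lambda>s. queue s \<noteq> {}) split_round s"
      by (rule loop_halts_measure[where I = "invariant A" and \<Phi> = "potential A", rotated])
        (rule wp_mono[OF round], auto)
    then show "case y of (s, t) \<Rightarrow> loop_halts (\<lambda>s. queue s \<noteq> {}) split_round s"
      by (simp add: st)
  qed
  have outcome: "\<exists>s. P = output_partition s \<and> invariant A s \<and> queue s = {} \<and>
      (\<exists>s0. initial_store A s0 \<and> t \<le> 4 + 2 * card (transitions A) + 7 * card (states A) + 58 * potential A s0)"
    if Pt: "(P, t) \<in> outcomes (fpcs A)"
  proof -
    obtain s0 t0 s t1 where s0: "(s0, t0) \<in> outcomes (init_store A)"
      and loop: "loop (\<lambda>s. queue s \<noteq> {}) split_round s0 s t1"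
      and P: "P = output_partition s" "t = t0 + t1"
      using Pt unfolding fpcs_def outcomes_bind by (auto simp: while_prog_def ret_def)
    have "invariant A s0"
      using init[OF s0] invariant_initial by blast
    \<comment> \<open>The 1 on the right turns the 3 of the initialisation into 4.\<close>
    with loop have "invariant A s \<and> \<not> queue s \<noteq> {} \<and> t1 + 58 * potential A s \<le> 1 + 58 * potential A s0"
      by (rule loop_amortised[where \<Phi> = "\<lambda>s. 58 * potential A s"]) (rule round)
    then show ?thesis
      using init[OF s0] P by (intro exI[of _ s] conjI exI[of _ s0]) auto
  qed
  show "is_minimal_quotient A (quotient_by A P)" if "(P, t) \<in> outcomes (fpcs A)"
    using outcome[OF that] minimal_quotient_of_invariant fin by blast
  show "t \<le> 4 + 2 * card (transitions A) + 7 * card (states A)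
         + 58 * ((3 * card (states A) + card (transitions A) + 2) * (floor_log (card (states A)) + 1))"
    if Pt: "(P, t) \<in> outcomes (fpcs A)" and n: "2 \<le> card (states A)"
  proof -
    obtain s0 where "initial_store A s0"
      "t \<le> 4 + 2 * card (transitions A) + 7 * card (states A) + 58 * potential A s0"
      using outcome[OF Pt] by blast
    then show ?thesis
      using initial_potential[OF fin _ n, of s0] by linarith
  qed
qed

text \<open>From \<open>2 \<le> n\<close> the logarithm is at least 1, so
  \<open>floor_log n + 1\<close> is at most twice the logarithm; moreover 4 is at most 2n, so both
  additive constants are absorbed into the factors 9 and 4 of m + n. This yields 9 + 58 * 4 * 2 =
  473, rounded up to 500.\<close>

lemma running_time_bound:
  fixes m n t :: nat
  assumes t: "t \<le> 4 + 2 * m + 7 * n + 58 * ((3 * n + m + 2) * (floor_log n + 1))" and n: "2 \<le> n"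
  shows "real t \<le> 500 * (real m + real n) * log 2 (real n)"
proof -
  let ?l = "log 2 (real n)" and ?S = "real m + real n"
  have "log 2 2 \<le> ?l"
    using n by (subst log_le_cancel_iff) auto
  then have l: "1 \<le> ?l"
    by simp
  have "2 ^ floor_log n \<le> n"
    using n by (intro floor_log_exp2_le) simp
  then have "real (floor_log n) \<le> ?l"
    using n by (intro le_log_of_power) (simp_all flip: of_nat_le_iff)
  then have fl: "real (floor_log n) + 1 \<le> 2 * ?l"
    using l by simp
  have "?S * 1 \<le> ?S * ?l"
    using l by (intro mult_left_mono) auto
  then have S: "?S \<le> ?S * ?l"
    by simp
  have "real t \<le> real (4 + 2 * m + 7 * n + 58 * ((3 * n + m + 2) * (floor_log n + 1)))"
    using t by (simp only: of_nat_le_iff)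
  also have "\<dots> = 4 + 2 * real m + 7 * real n + 58 * ((3 * real n + real m + 2) * (real (floor_log n) + 1))"
    by (simp only: of_nat_add of_nat_mult of_nat_numeral of_nat_1)
  also have "\<dots> \<le> 9 * ?S + 58 * ((4 * ?S) * (2 * ?l))"
    using n fl l by (intro add_mono mult_left_mono mult_mono) auto
  also have "\<dots> \<le> 9 * (?S * ?l) + 58 * ((4 * ?S) * (2 * ?l))"
    using S by (intro add_mono mult_left_mono) auto
  also have "\<dots> = 473 * (?S * ?l)"
    by (simp add: algebra_simps)
  also have "\<dots> \<le> 500 * (?S * ?l)"
    using S by (intro mult_right_mono) auto
  finally show ?thesis
    by (simp only: mult.assoc)
qed

theorem theorem6p4:
  shows "\<exists>c::real. \<forall>A :: ('q, 'a::finite, 'k::{semiring_0, monoid_mult}) automaton.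
           finite (states A) \<and> simplifiable_signatures A \<longrightarrow>
             fpcs_halts A \<and>
             (\<forall>(P, t) \<in> outcomes (fpcs A).
                is_minimal_quotient A (quotient_by A P) \<and>
                (card (states A) \<ge> 2 \<longrightarrow>
                   real t \<le> c * (real (card (transitions A)) + real (card (states A)))
                              * log 2 (real (card (states A)))))"
proof (intro exI[of _ 500] allI impI, elim conjE)
  fix A :: "('q, 'a, 'k) automaton"
  assume A: "finite (states A)" "simplifiable_signatures A"
  show "fpcs_halts A \<and>
             (\<forall>(P, t) \<in> outcomes (fpcs A).
                is_minimal_quotient A (quotient_by A P) \<and>
                (card (states A) \<ge> 2 \<longrightarrow>
                   real t \<le> 500 * (real (card (transitions A)) + real (card (states A)))
                              * log 2 (real (card (states A)))))"
    using fpcs_correct[OF A] running_time_bound by (intro conjI ballI) auto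
qed

end
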